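(* Let $A,B:\mathrm{dom}\,A\to\mathbb{R}^{m_\zeta\times m_\zeta}$ have the same hybrid time domain, let $\nu:\mathrm{dom}\,A\to\mathbb{R}^{m_\zeta}$, and consider the hybrid system $$\mathcal{H}'_\nu:\quad\begin{cases}\dot\zeta=-A(t,j)\zeta+\nu(t,j), & t\in\mathrm{int}(I^j_A),\\ \zeta^+=[I_{m_\zeta}-B(t,j)]\zeta+\nu(t,j), & (t,j),(t,j+1)\in\mathrm{dom}\,A,\end{cases}$$ where $\mathcal{H}'_0$ denotes the system with $\nu\equiv0$. Assume that: (1) (uniform boundedness) there exist $\bar A,\bar B>0$ such that $|A(t,j)|\le\bar A$ and $|B(t,j)|\le\bar B$ for all $(t,j)\in\mathrm{dom}\,A$; (2) (structural properties) for each $(t,j)\in\mathrm{dom}\,A$, $A(t,j)=A(t,j)^\top\ge0$, $B(t,j)=B(t,j)^\top\ge0$, and $|B(t,j)|\le1$; (3) the pair $(A,B)$ is hybrid persistently exciting (HPE). Then the origin $\{\zeta=0\}$ is uniformly exponentially stable (UES) for $\mathcal{H}'_0$, and $\mathcal{H}'_\nu$ is input-to-state stable (ISS) with respect to $\nu$.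
   Context: Hybrid time domains. A hybrid signal is a function on a hybrid time domain $\mathrm{dom}\subset\mathbb{R}_{\ge0}\times\mathbb{Z}_{\ge0}$, i.e. a set such that for each $(T,J)$ in it, its intersection with $[0,T]\times\{0,\dots,J\}$ is $\bigcup_{j=0}^J[t_j,t_{j+1}]\times\{j\}$ for some $0=t_0\le\dots\le t_{J+1}=T$. Put $I^j_A:=\{t:(t,j)\in\mathrm{dom}\,A\}$. A hybrid arc is a hybrid signal that is locally absolutely continuous in $t$ on each $I^j$. Solutions $\zeta$ to $\mathcal{H}'_\nu$, starting from $\zeta_o\in\mathbb{R}^{m_\zeta}$ at $(t_o,j_o)\in\mathrm{dom}\,A$, are hybrid arcs whose domain is the part of $\mathrm{dom}\,A$ from $(t_o,j_o)$ on (or a portion of it), satisfying the differential equation for almost all $t\in I^j_A$ and $\zeta(t,j+1)=[I-B(t,j)]\zeta(t,j)+\nu(t,j)$ at the jumps; they jump exactly when $A$ jumps. $|\cdot|$ is the Euclidean (induced) norm; matrix inequalities are in the semidefinite order. Hybrid integral. For $(t,j)\in\mathrm{dom}\,\phi$ and $K\in\mathbb{R}_{>0}\cup\{+\infty\}$, $E^\phi_{t,j,K}\subset\mathrm{dom}\,\phi$ is the shortest hybrid time domain starting from $(t,j)$, contained in $\mathrm{dom}\,\phi$, of length (elapsed ordinary time plus number of jumps) at least $K$; $E^\phi_{t,j,\infty}$ is the whole part of $\mathrm{dom}\,\phi$ from $(t,j)$ on. Writing $E^\phi_{t,j,K}=\bigcup_{i=j}^{m_K}[t_i,t_{i+1}]\times\{i\}$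 with $t_j:=t$, $$\int_{E^\phi_{t,j,K}}g(s,i)\,d(s,i):=\sum_{i=j}^{m_K}\int_{t_i}^{t_{i+1}}g(s,i)\,ds+\sum_{i=j}^{m_K-1}g(t_{i+1},i).$$ HPE. A pair $(A,B)$ of hybrid arcs $A,B:\mathrm{dom}\,A\to\mathbb{R}^{m_\zeta\times m_\zeta}$ with $\mathrm{dom}\,A=\mathrm{dom}\,B$ is HPE if there exist $K,\mu>0$ such that $$\int_{E^A_{t_o,j_o,K}}\Phi_{AB}(s,i)\,d(s,i)\ge\mu I_{m_\zeta}\qquad\forall(t_o,j_o)\in\mathrm{dom}\,A,$$ where $\Phi_{AB}(t,j):=A(t,j)$ if $t\in\mathrm{int}(I^j_A)$ and $\Phi_{AB}(t,j):=B(t,j)$ otherwise. UES. The origin is UES for $\mathcal{H}'_0$ if there exist $\kappa,\lambda>0$, independent of $(t_o,j_o)$ and $\zeta_o$, such that every solution $\zeta$ starting at $(t_o,j_o)$ from $\zeta_o$ satisfies $|\zeta(t,j)|\le\kappa|\zeta_o|e^{-\lambda(t+j-t_o-j_o)}$ for all $(t,j)\in\mathrm{dom}\,\zeta$. ISS. $\mathcal{H}'_\nu$ is ISS with respect to $\nu$ if there exist a class $\mathcal{K}_\infty$ function $\alpha$ and a class $\mathcal{KL}$ function $\beta$ such that each solution $\zeta$ to $\mathcal{H}'_\nu$ starting from $\zeta_o$ at $(t_o,j_o)\in\mathrm{dom}\,A$ satisfies $$|\zeta(t,j)|\le\beta(|\zeta_o|,t+j-t_o-j_o)+\alpha\big(\sup\{|\nu(s,i)|:(s,i)\in\mathrm{dom}\,\zeta\setminus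 E^\zeta_{t,j,\infty}\}\big)$$ for all $(t,j)\in E^\zeta_{t_o,j_o,\infty}$. *)

theory Defs
  imports "HOL-Analysis.Analysis"
begin

section \<open>Hybrid time domains and hybrid arcs\<close>

text \<open>Signals on a hybrid time domain \<open>D\<close> are total functions of \<open>(t, j)\<close>; only their values
  on \<open>D\<close> are used.\<close>

type_synonym 'a hybrid_signal = "real \<Rightarrow> nat \<Rightarrow> 'a"

definition slice :: "(real \<times> nat) set \<Rightarrow> nat \<Rightarrow> real set" where
  "slice D j = {t. (t, j) \<in> D}"

text \<open>\<open>\<tau> j, ..., \<tau> (Suc J)\<close> are the times of the compact hybrid time domain
  \<open>\<Union>i=j..J. [\<tau> i, \<tau> (i+1)] \<times> {i}\<close> from \<open>(t, j)\<close> to \<open>(T, J)\<close>.\<close>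

definition hybrid_times :: "(nat \<Rightarrow> real) \<Rightarrow> real \<Rightarrow> nat \<Rightarrow> real \<Rightarrow> nat \<Rightarrow> bool" where
  "hybrid_times \<tau> t j T J \<longleftrightarrow>
     j \<le> J \<and> \<tau> j = t \<and> \<tau> (Suc J) = T \<and> (\<forall>i\<in>{j..J}. \<tau> i \<le> \<tau> (Suc i))"

definition hybrid_segment :: "(nat \<Rightarrow> real) \<Rightarrow> nat \<Rightarrow> nat \<Rightarrow> (real \<times> nat) set" where
  "hybrid_segment \<tau> j J = (\<Union>i\<in>{j..J}. {\<tau> i..\<tau> (Suc i)} \<times> {i})"

definition hybrid_time_domain_from :: "real \<Rightarrow> nat \<Rightarrow> (real \<times> nat) set \<Rightarrow> bool" where
  "hybrid_time_domain_from t0 j0 D \<longleftrightarrow>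
     D \<subseteq> {t0..} \<times> {j0..} \<and>
     (\<forall>(T, J)\<in>D. \<exists>\<tau>. hybrid_times \<tau> t0 j0 T J \<and>
        D \<inter> ({t0..T} \<times> {j0..J}) = hybrid_segment \<tau> j0 J)"

abbreviation hybrid_time_domain :: "(real \<times> nat) set \<Rightarrow> bool" where
  "hybrid_time_domain \<equiv> hybrid_time_domain_from 0 0"

text \<open>The cells of a \<open>division_of\<close> are nonoverlapping compact intervals \<open>[Inf k, Sup k]\<close>.\<close>

definition absolutely_continuous_fun_on :: "real set \<Rightarrow> (real \<Rightarrow> 'a::real_normed_vector) \<Rightarrow> bool" where
  "absolutely_continuous_fun_on S f \<longleftrightarrow>
     (\<forall>\<epsilon>>0. \<exists>\<delta>>0. \<forall>d X. d division_of X \<longrightarrow> X \<subseteq> S \<longrightarrow> (\<Sum>k\<in>d. Sup k - Inf k) < \<delta> \<longrightarrow>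
        (\<Sum>k\<in>d. norm (f (Sup k) - f (Inf k))) < \<epsilon>)"

definition locally_absolutely_continuous_on :: "real set \<Rightarrow> (real \<Rightarrow> 'a::real_normed_vector) \<Rightarrow> bool" where
  "locally_absolutely_continuous_on S f \<longleftrightarrow>
     (\<forall>a b. {a..b} \<subseteq> S \<longrightarrow> absolutely_continuous_fun_on {a..b} f)"

definition hybrid_arc :: "(real \<times> nat) set \<Rightarrow> 'a::real_normed_vector hybrid_signal \<Rightarrow> bool" where
  "hybrid_arc D f \<longleftrightarrow> (\<forall>j. locally_absolutely_continuous_on (slice D j) (\<lambda>t. f t j))"


section \<open>Hybrid integral and hybrid persistency of excitation\<close>

text \<open>The whole part of \<open>D\<close> from \<open>(t, j)\<close> on, i.e. \<open>E\<^sub>t\<^sub>,\<^sub>j\<^sub>,\<^sub>\<infinity>\<close>.\<close>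

definition hybrid_from :: "(real \<times> nat) set \<Rightarrow> real \<Rightarrow> nat \<Rightarrow> (real \<times> nat) set" where
  "hybrid_from D t j = {(s, i) \<in> D. t \<le> s \<and> j \<le> i}"

text \<open>\<open>\<tau>\<close> and \<open>m\<close> describe \<open>E\<^sub>t\<^sub>,\<^sub>j\<^sub>,\<^sub>K\<close> for finite \<open>K\<close>. No such window exists
  when the part of \<open>D\<close> from \<open>(t, j)\<close> on is shorter than \<open>K\<close>.\<close>

definition hybrid_window ::
  "(real \<times> nat) set \<Rightarrow> real \<Rightarrow> nat \<Rightarrow> real \<Rightarrow> (nat \<Rightarrow> real) \<Rightarrow> nat \<Rightarrow> bool" where
  "hybrid_window D t j K \<tau> m \<longleftrightarrow>
     (\<exists>T. hybrid_times \<tau> t j T m \<and> hybrid_segment \<tau> j m \<subseteq> D \<and>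
        K \<le> (T - t) + (real m - real j) \<and>
        (\<forall>\<tau>' T' m'. hybrid_times \<tau>' t j T' m' \<longrightarrow> hybrid_segment \<tau>' j m' \<subseteq> D \<longrightarrow>
           K \<le> (T' - t) + (real m' - real j) \<longrightarrow>
           (T - t) + (real m - real j) \<le> (T' - t) + (real m' - real j)))"

definition hybrid_integral ::
  "(nat \<Rightarrow> real) \<Rightarrow> nat \<Rightarrow> nat \<Rightarrow> 'a::euclidean_space hybrid_signal \<Rightarrow> 'a" where
  "hybrid_integral \<tau> j m g =
     (\<Sum>i\<in>{j..m}. integral {\<tau> i..\<tau> (Suc i)} (\<lambda>s. g s i)) + (\<Sum>i\<in>{j..<m}. g (\<tau> (Suc i)) i)"

definition pos_semidef :: "real^'n^'n \<Rightarrow> bool" where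
  "pos_semidef M \<longleftrightarrow> transpose M = M \<and> (\<forall>x. 0 \<le> x \<bullet> (M *v x))"

definition loewner_le :: "real^'n^'n \<Rightarrow> real^'n^'n \<Rightarrow> bool" where
  "loewner_le M N \<longleftrightarrow> pos_semidef (N - M)"

text \<open>\<open>norm\<close> on \<open>real^'n^'n\<close> is the Frobenius norm, hence a separate induced norm.\<close>

definition matrix_norm :: "real^'n^'m \<Rightarrow> real" where
  "matrix_norm M = onorm ((*v) M)"

definition Phi ::
  "(real \<times> nat) set \<Rightarrow> (real^'n^'n) hybrid_signal \<Rightarrow> (real^'n^'n) hybrid_signal \<Rightarrow> (real^'n^'n) hybrid_signal" where
  "Phi D A B t j = (if t \<in> interior (slice D j) then A t j else B t j)"

definition HPE ::
  "(real \<times> nat) set \<Rightarrow> (real^'n^'n) hybrid_signal \<Rightarrow> (real^'n^'n) hybrid_signal \<Rightarrow> bool" where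
  "HPE D A B \<longleftrightarrow>
     hybrid_arc D A \<and> hybrid_arc D B \<and>
     (\<exists>K>0. \<exists>\<mu>>0. \<forall>(t0, j0)\<in>D. \<exists>\<tau> m. hybrid_window D t0 j0 K \<tau> m \<and>
        loewner_le (\<mu> *\<^sub>R mat 1) (hybrid_integral \<tau> j0 m (Phi D A B)))"


section \<open>Solutions and stability\<close>

text \<open>\<open>S\<close> is the domain of \<open>\<zeta>\<close>. Being a hybrid time domain from \<open>(t0, j0)\<close> contained in \<open>D\<close>,
  it is an initial portion of the part of \<open>D\<close> from \<open>(t0, j0)\<close> on, so inside \<open>S\<close> the solution
  jumps exactly when \<open>D\<close> does.\<close>

definition hybrid_solution ::
  "(real \<times> nat) set \<Rightarrow> (real^'n^'n) hybrid_signal \<Rightarrow> (real^'n^'n) hybrid_signal \<Rightarrow> (real^'n) hybrid_signal \<Rightarrow>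
   real \<Rightarrow> nat \<Rightarrow> real^'n \<Rightarrow> (real \<times> nat) set \<Rightarrow> (real^'n) hybrid_signal \<Rightarrow> bool" where
  "hybrid_solution D A B \<nu> t0 j0 \<zeta>0 S \<zeta> \<longleftrightarrow>
     (t0, j0) \<in> S \<and> S \<subseteq> D \<and> hybrid_time_domain_from t0 j0 S \<and> hybrid_arc S \<zeta> \<and>
     \<zeta> t0 j0 = \<zeta>0 \<and>
     (\<forall>j. AE t in lebesgue. t \<in> slice S j \<and> t \<in> interior (slice D j) \<longrightarrow>
        ((\<lambda>s. \<zeta> s j) has_vector_derivative (- (A t j *v \<zeta> t j) + \<nu> t j)) (at t within slice S j)) \<and>
     (\<forall>t j. (t, j) \<in> S \<and> (t, Suc j) \<in> S \<longrightarrow>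
        \<zeta> t (Suc j) = (mat 1 - B t j) *v \<zeta> t j + \<nu> t j)"

definition UES ::
  "(real \<times> nat) set \<Rightarrow> (real^'n^'n) hybrid_signal \<Rightarrow> (real^'n^'n) hybrid_signal \<Rightarrow> bool" where
  "UES D A B \<longleftrightarrow>
     (\<exists>\<kappa>>0. \<exists>rate>0. \<forall>t0 j0 \<zeta>0 S \<zeta>. (t0, j0) \<in> D \<longrightarrow>
        hybrid_solution D A B (\<lambda>_ _. 0) t0 j0 \<zeta>0 S \<zeta> \<longrightarrow>
        (\<forall>(t, j)\<in>S. norm (\<zeta> t j) \<le> \<kappa> * norm \<zeta>0 * exp (- rate * (t + real j - t0 - real j0))))"

definition class_K :: "(real \<Rightarrow> real) \<Rightarrow> bool" where
  "class_K \<alpha> \<longleftrightarrow> \<alpha> 0 = 0 \<and> continuous_on {0..} \<alpha> \<and> strict_mono_on {0..} \<alpha>"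

definition class_K_inf :: "(real \<Rightarrow> real) \<Rightarrow> bool" where
  "class_K_inf \<alpha> \<longleftrightarrow> class_K \<alpha> \<and> filterlim \<alpha> at_top at_top"

definition class_KL :: "(real \<Rightarrow> real \<Rightarrow> real) \<Rightarrow> bool" where
  "class_KL \<beta> \<longleftrightarrow>
     continuous_on ({0..} \<times> {0..}) (\<lambda>(r, s). \<beta> r s) \<and>
     (\<forall>s\<ge>0. class_K (\<lambda>r. \<beta> r s)) \<and>
     (\<forall>r\<ge>0. antimono_on {0..} (\<beta> r) \<and> (\<beta> r \<longlongrightarrow> 0) at_top)"

text \<open>Suprema are taken in \<open>[0, \<infinity>]\<close>: the supremum over the empty set is \<open>0\<close> (hence \<open>insert 0\<close>),
  and an infinite supremum makes the bound void (hence the \<open>bdd_above\<close> guard).\<close>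

definition ISS ::
  "(real \<times> nat) set \<Rightarrow> (real^'n^'n) hybrid_signal \<Rightarrow> (real^'n^'n) hybrid_signal \<Rightarrow> (real^'n) hybrid_signal \<Rightarrow> bool" where
  "ISS D A B \<nu> \<longleftrightarrow>
     (\<exists>\<alpha> \<beta>. class_K_inf \<alpha> \<and> class_KL \<beta> \<and>
        (\<forall>t0 j0 \<zeta>0 S \<zeta>. (t0, j0) \<in> D \<longrightarrow> hybrid_solution D A B \<nu> t0 j0 \<zeta>0 S \<zeta> \<longrightarrow>
           (\<forall>(t, j)\<in>hybrid_from S t0 j0.
              let V = (\<lambda>(s, i). norm (\<nu> s i)) ` (S - hybrid_from S t j) in
              bdd_above V \<longrightarrow>
              norm (\<zeta> t j) \<le> \<beta> (norm \<zeta>0) (t + real j - t0 - real j0) + \<alpha> (Sup (insert 0 V)))))"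

end

theory Submission
  imports Defs
begin

text \<open>
  Put \<open>V = |\<zeta>|\<^sup>2\<close> and let \<open>P\<close> stand for \<open>A\<close> during flows and for \<open>B\<close> at jumps. Without input, a flow
  dissipates \<open>2 \<zeta> \<bullet> P \<zeta>\<close> per unit of time, and a jump dissipates at least \<open>\<zeta> \<bullet> P \<zeta>\<close>, because
  \<open>0 \<le> B \<le> I\<close> gives \<open>B\<^sup>2 \<le> B\<close>. So the decrease of \<open>V\<close> across a window is at least the hybrid integral \<open>Q\<close>
  of \<open>\<zeta> \<bullet> P \<zeta>\<close>, and it remains to bound \<open>Q\<close> below by a multiple of \<open>V\<close> at the start \<open>z0\<close> of the window.
  If \<open>Q\<close> is small, then \<open>\<zeta>\<close> hardly moves: with a bound \<open>c \<ge> 1\<close> on \<open>|P|\<close>, \<open>|P \<zeta>|\<^sup>2 \<le> c (\<zeta> \<bullet> P \<zeta>)\<close> and the Cauchy-Schwarz inequality show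
  that \<open>|\<zeta> - z0|\<^sup>2\<close> is at most \<open>c\<close> times the length of the window times \<open>Q\<close>
  (\<open>total_variation_sq_le\<close>). Hence the integral of \<open>\<zeta> \<bullet> P \<zeta>\<close> is comparable to that of \<open>z0 \<bullet> P z0\<close>, which is at
  least \<open>\<mu> |z0|\<^sup>2\<close> by persistency of excitation (\<open>excitation_le_dissipation\<close>). Every window therefore
  contracts \<open>V\<close> by a fixed factor, and windows have length at most \<open>K + 1\<close>.

  The same computation is carried out with the input present, at the price of a term \<open>C N\<^sup>2\<close> when
  \<open>|\<nu>| \<le> N\<close> (\<open>window_contraction\<close>). Iterating \<open>V \<mapsto> \<rho> V + C N\<^sup>2\<close> gives one estimate,
  \<open>|\<zeta>| \<le> \<kappa> |\<zeta>0| exp (- r \<ell>) + g N\<close> with \<open>\<ell>\<close> the elapsed hybrid time (\<open>exponential_iss\<close>), that contains both uniform exponential stability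
  (\<open>N = 0\<close>) and input-to-state stability.

  Two points need care. The differential equation holds only almost everywhere, so everything
  rests on the fundamental theorem of calculus for absolutely continuous functions
  (\<open>absolutely_continuous_ftc\<close>). And a hybrid time domain, as a set, may fork: the set
  \<open>[0,\<infinity>) \<times> {0} \<union> {1} \<times> \<nat>\<close> satisfies the definition, although from \<open>(1, 0)\<close> one can both flow on and jump.
  At a fork the window supplied by persistency of excitation may leave the solution, and \<open>Phi\<close> selects
  \<open>A\<close> at a jump. But a domain forks at most once (\<open>branch_point_unique\<close>), so the windows are used
  only beyond the fork. The part of a trajectory before that has bounded length, does not expand \<open>V\<close> beyond
  the effect of the input, and only enlarges \<open>\<kappa>\<close> and the gain.
\<close>

section \<open>Absolutely continuous functions\<close>

lemma absolutely_continuous_fun_on_dominated: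
  assumes f: "absolutely_continuous_fun_on {a..b::real} f"
    and C: "C > 0"
    and dom: "\<And>x y. x \<in> {a..b} \<Longrightarrow> y \<in> {a..b} \<Longrightarrow> norm (g x - g y) \<le> C * norm (f x - f y)"
  shows "absolutely_continuous_fun_on {a..b} g"
  unfolding absolutely_continuous_fun_on_def
proof (intro allI impI)
  fix e :: real assume "e > 0"
  with C have "e / C > 0" by simp
  then obtain \<delta> where "\<delta> > 0" and \<delta>: "\<And>d X. d division_of X \<Longrightarrow> X \<subseteq> {a..b} \<Longrightarrow>
      (\<Sum>k\<in>d. Sup k - Inf k) < \<delta> \<Longrightarrow> (\<Sum>k\<in>d. norm (f (Sup k) - f (Inf k))) < e / C"
    using f unfolding absolutely_continuous_fun_on_def by metis
  have "(\<Sum>k\<in>d. norm (g (Sup k) - g (Inf k))) < e"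
    if d: "d division_of X" "X \<subseteq> {a..b}" "(\<Sum>k\<in>d. Sup k - Inf k) < \<delta>" for d X
  proof -
    have ends: "Sup k \<in> {a..b} \<and> Inf k \<in> {a..b}" if kd: "k \<in> d" for k
    proof -
      obtain u v where k: "k = cbox u v" "k \<noteq> {}" "k \<subseteq> {a..b}"
        using division_ofD(2-4)[OF d(1) kd] d(2) by blast
      then have "u \<le> v" by auto
      with k show ?thesis by auto
    qed
    have "(\<Sum>k\<in>d. norm (g (Sup k) - g (Inf k))) \<le> (\<Sum>k\<in>d. C * norm (f (Sup k) - f (Inf k)))"
      using ends by (intro sum_mono dom) auto
    also have "\<dots> = C * (\<Sum>k\<in>d. norm (f (Sup k) - f (Inf k)))"
      by (simp add: sum_distrib_left)
    also have "\<dots> < C * (e / C)"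
      using \<delta>[OF d] C by (intro mult_strict_left_mono) auto
    finally show ?thesis using C by simp
  qed
  then show "\<exists>\<delta>>0. \<forall>d X. d division_of X \<longrightarrow> X \<subseteq> {a..b} \<longrightarrow> (\<Sum>k\<in>d. Sup k - Inf k) < \<delta> \<longrightarrow>
      (\<Sum>k\<in>d. norm (g (Sup k) - g (Inf k))) < e"
    using \<open>\<delta> > 0\<close> by blast
qed

lemma absolutely_continuous_fun_on_subset:
  "absolutely_continuous_fun_on S f \<Longrightarrow> T \<subseteq> S \<Longrightarrow> absolutely_continuous_fun_on T f"
  unfolding absolutely_continuous_fun_on_def by (meson order_trans)

lemma absolutely_continuous_imp_continuous_on:
  assumes f: "absolutely_continuous_fun_on {a..b::real} f"
  shows "continuous_on {a..b} f"
  unfolding continuous_on_iff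
proof (intro ballI allI impI)
  fix x e :: real assume x: "x \<in> {a..b}" and "e > 0"
  then obtain \<delta> where "\<delta> > 0" and \<delta>: "\<And>d X. d division_of X \<Longrightarrow> X \<subseteq> {a..b} \<Longrightarrow>
      (\<Sum>k\<in>d. Sup k - Inf k) < \<delta> \<Longrightarrow> (\<Sum>k\<in>d. norm (f (Sup k) - f (Inf k))) < e"
    using f unfolding absolutely_continuous_fun_on_def by metis
  have "dist (f y) (f x) < e" if y: "y \<in> {a..b}" "dist y x < \<delta>" for y
  proof -
    define u v where "u = min x y" and "v = max x y"
    have uv: "u \<le> v" "{u..v} \<subseteq> {a..b}" "v - u < \<delta>"
      using x y by (auto simp: u_def v_def dist_real_def)
    have "{{u..v}} division_of {u..v}"
      using division_of_self[of u v] uv by auto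
    from \<delta>[OF this uv(2)] uv have "norm (f v - f u) < e" by simp
    then show ?thesis
      by (auto simp: u_def v_def dist_norm min_def max_def norm_minus_commute split: if_splits)
  qed
  then show "\<exists>d>0. \<forall>x'\<in>{a..b}. dist x' x < d \<longrightarrow> dist (f x') (f x) < e"
    using \<open>\<delta> > 0\<close> by blast
qed

text \<open>The proof of the fundamental theorem for the gauge integral, with one change. The exceptional set
  lies in an open set of small measure, and the gauge keeps every cell tagged by an exceptional point inside
  that open set. The cells so tagged have small total length, so absolute continuity bounds the total
  increment of \<open>f\<close> over them, and the integrand may be taken to be \<open>0\<close> there.\<close>

theorem absolutely_continuous_ftc:
  fixes f :: "real \<Rightarrow> 'a::banach"
  assumes "a \<le> b" and ac: "absolutely_continuous_fun_on {a..b} f"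
    and N: "negligible N"
    and deriv: "\<And>x. x \<in> {a..b} - N \<Longrightarrow> (f has_vector_derivative f' x) (at x within {a..b})"
  shows "(f' has_integral (f b - f a)) {a..b}"
proof (cases "a = b")
  case True
  then show ?thesis using has_integral_refl(2)[of f' a] by simp
next
  case False
  with \<open>a \<le> b\<close> have "a < b" by simp
  define g where "g x = (if x \<in> N then 0 else f' x)" for x
  have "(g has_integral (f b - f a)) (cbox a b)"
    unfolding has_integral_factor_content
  proof safe
    fix e :: real
    assume "e > 0"
    have "\<exists>d>0. x \<in> {a..b} - N \<longrightarrow>
         (\<forall>y\<in>{a..b}. norm (y-x) < d \<longrightarrow> norm (f y - f x - (y-x) *\<^sub>R g x) \<le> e/2 * norm (y-x))" for x
    proof (cases "x \<in> {a..b} - N")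
      case True
      then have "g x = f' x" by (simp add: g_def)
      with deriv[OF True] show ?thesis
        unfolding has_vector_derivative_def has_derivative_within_alt
        using half_gt_zero[OF \<open>e > 0\<close>] by metis
    next
      case False then show ?thesis by (intro exI[of _ 1]) auto
    qed
    then obtain d where d: "\<And>x. 0 < d x"
                 "\<And>x y. \<lbrakk>x \<in> {a..b} - N; y \<in> {a..b}; norm (y-x) < d x\<rbrakk>
                        \<Longrightarrow> norm (f y - f x - (y-x) *\<^sub>R g x) \<le> e/2 * norm (y-x)"
      by metis
    have "e/2 * (b - a) > 0" using \<open>e > 0\<close> \<open>a < b\<close> by simp
    then obtain \<delta> where "\<delta> > 0" and \<delta>: "\<And>d X. d division_of X \<Longrightarrow> X \<subseteq> {a..b} \<Longrightarrow>
        (\<Sum>k\<in>d. Sup k - Inf k) < \<delta> \<Longrightarrow> (\<Sum>k\<in>d. norm (f (Sup k) - f (Inf k))) < e/2 * (b - a)"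
      using ac unfolding absolutely_continuous_fun_on_def by metis
    have "N \<in> null_sets lebesgue" using N negligible_iff_null_sets by blast
    then obtain U where U: "open U" "N \<subseteq> U" "U - N \<in> lmeasurable" "emeasure lebesgue (U - N) < ennreal \<delta>"
      using sets_lebesgue_outer_open \<open>\<delta> > 0\<close> by blast
    have neg: "U = (U - N) \<union> N" using U by auto
    have Um: "U \<in> lmeasurable"
      by (subst neg) (intro fmeasurable.Un U negligible_imp_measurable N)
    have "emeasure lebesgue U \<le> emeasure lebesgue (U - N) + emeasure lebesgue N"
      by (subst neg) (use U N \<open>N \<in> null_sets lebesgue\<close> in \<open>intro emeasure_subadditive\<close>, auto)
    then have "emeasure lebesgue U < ennreal \<delta>"
      using U(4) \<open>N \<in> null_sets lebesgue\<close> by (simp add: null_setsD1)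
    then have Umeas: "measure lebesgue U < \<delta>"
      using Um \<open>\<delta> > 0\<close> by (simp add: emeasure_eq_measure2 ennreal_less_iff)
    define G where "G x = (if x \<in> N then U \<inter> ball x (d x) else ball x (d x))" for x
    show "\<exists>d. gauge d \<and> (\<forall>p. p tagged_division_of (cbox a b) \<and> d fine p \<longrightarrow>
      norm ((\<Sum>(x, k)\<in>p. measure lborel k *\<^sub>R g x) - (f b - f a)) \<le> e * measure lborel (cbox a b))"
    proof (rule exI, safe)
      show "gauge G"
        using U d(1) by (auto simp: gauge_def G_def)
    next
      fix p
      assume ptag: "p tagged_division_of cbox a b" and finep: "G fine p"
      have "finite p" using ptag by blast
      define q where "q = {(x, K) \<in> p. x \<in> N}"
      have q: "q \<subseteq> p" by (auto simp: q_def)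
      let ?\<Delta> = "\<lambda>K. f (Sup K) - f (Inf K)"
      have ba: "b - a = (\<Sum>(x,K)\<in>p. Sup K - Inf K)" "f b - f a = (\<Sum>(x,K)\<in>p. ?\<Delta> K)"
        using additive_tagged_division_1[where f= "\<lambda>x. x"] additive_tagged_division_1[where f= f]
              \<open>a \<le> b\<close> ptag by auto
      have bound: "norm (measure lborel K *\<^sub>R g x - ?\<Delta> K) \<le> e/2 * (Sup K - Inf K)"
        if xK: "(x, K) \<in> p" and "x \<notin> N" for x K
      proof -
        obtain u v where k: "K = cbox u v" and "x \<in> K" and kab: "K \<subseteq> cbox a b"
          using ptag \<open>(x, K) \<in> p\<close> by blast
        have "u \<le> v"
          using \<open>x \<in> K\<close> unfolding k by auto
        have ball: "\<forall>y\<in>K. y \<in> ball x (d x)"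
          using fineD[OF finep xK] \<open>x \<notin> N\<close> by (auto simp: G_def)
        have "u \<in> K" "v \<in> K"
          by (simp_all add: \<open>u \<le> v\<close> k)
        have "norm ((v - u) *\<^sub>R g x - (f v - f u)) = norm (f u - f x - (u - x) *\<^sub>R g x - (f v - f x - (v - x) *\<^sub>R g x))"
          by (auto simp: algebra_simps)
        also have "\<dots> \<le> norm (f u - f x - (u - x) *\<^sub>R g x) + norm (f v - f x - (v - x) *\<^sub>R g x)"
          by (rule norm_triangle_ineq4)
        also have "\<dots> \<le> e/2 * norm (u - x) + e/2 * norm (v - x)"
        proof (rule add_mono)
          show "norm (f u - f x - (u - x) *\<^sub>R g x) \<le> e/2 * norm (u - x)"
            by (rule d) (use \<open>x \<in> K\<close> \<open>u \<in> K\<close> kab ball \<open>x \<notin> N\<close> in \<open>auto simp: dist_real_def\<close>)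
          show "norm (f v - f x - (v - x) *\<^sub>R g x) \<le> e/2 * norm (v - x)"
            by (rule d) (use \<open>x \<in> K\<close> \<open>v \<in> K\<close> kab ball \<open>x \<notin> N\<close> in \<open>auto simp: dist_real_def\<close>)
        qed
        also have "\<dots> = e/2 * (Sup K - Inf K)"
          using \<open>x \<in> K\<close> by (auto simp: k interval_bounds_real[OF \<open>u \<le> v\<close>] field_simps)
        finally show ?thesis
          using \<open>u \<le> v\<close> by (simp add: k)
      qed
      have "q tagged_partial_division_of cbox a b"
        using ptag q unfolding tagged_division_of_def by (blast intro: tagged_partial_division_subset)
      note qd = partial_division_of_tagged_division[OF this]
        and qt = tagged_partial_division_of_Union_self[OF this]
      have qU: "\<Union>(snd ` q) \<subseteq> U"
      proof safe
        fix y x K assume "(x, K) \<in> q" "y \<in> snd (x, K)"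
        then show "y \<in> U" using fineD[OF finep, of x K] by (auto simp: q_def G_def)
      qed
      have qab: "\<Union>(snd ` q) \<subseteq> {a..b}"
      proof safe
        fix y x K assume "(x, K) \<in> q" "y \<in> snd (x, K)"
        then show "y \<in> {a..b}" using tagged_division_ofD(3)[OF ptag, of x K] q
          by (metis box_real(2) snd_conv subsetD)
      qed
      have qK: "Sup K - Inf K = measure lebesgue K" if Kq: "K \<in> snd ` q" for K
      proof -
        obtain u v where k: "K = cbox u v" "K \<noteq> {}"
          using division_ofD(3,4)[OF qd Kq] by blast
        then have "u \<le> v" by auto
        with k show ?thesis by simp
      qed
      have "(\<Sum>K\<in>snd ` q. Sup K - Inf K) = measure lebesgue (\<Union>(snd ` q))"
        using content_division[OF qd] qK by simp
      also have "\<dots> \<le> measure lebesgue U"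
        using lmeasurable_division[OF qd] by (intro measure_mono_fmeasurable qU Um) auto
      finally have "(\<Sum>K\<in>snd ` q. norm (?\<Delta> K)) < e/2 * (b - a)"
        using Umeas by (intro \<delta>[OF qd qab]) simp
      moreover have "(\<Sum>(x, K)\<in>q. norm (?\<Delta> K)) = (\<Sum>K\<in>snd ` q. norm (?\<Delta> K))"
      proof -
        (* On the empty set Sup and Inf are unspecified, so the empty cell gets weight 0. *)
        let ?h = "\<lambda>K. if K = {} then 0 else norm (?\<Delta> K)"
        have nonempty: "K \<noteq> {}" if "K \<in> snd ` q" for K
          using division_ofD(3)[OF qd that] .
        have "(\<Sum>(x, K)\<in>q. ?h K) = (\<Sum>K\<in>snd ` q. ?h K)"
        proof (rule sum.over_tagged_division_lemma[OF qt])
          fix u v :: real assume "box u v = {}"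
          then have "v \<le> u" by (simp add: box_eq_empty)
          then show "?h (cbox u v) = 0"
            by (cases "u = v") auto
        qed
        moreover have "(\<Sum>(x, K)\<in>q. ?h K) = (\<Sum>(x, K)\<in>q. norm (?\<Delta> K))"
          using nonempty by (intro sum.cong) force+
        moreover have "(\<Sum>K\<in>snd ` q. ?h K) = (\<Sum>K\<in>snd ` q. norm (?\<Delta> K))"
          using nonempty by (intro sum.cong) auto
        ultimately show ?thesis by simp
      qed
      ultimately have q_small: "(\<Sum>(x, K)\<in>q. norm (?\<Delta> K)) \<le> e/2 * (b - a)" by simp
      have "norm (\<Sum>(x, K)\<in>p. measure lborel K *\<^sub>R g x - ?\<Delta> K)
          \<le> (\<Sum>z\<in>p. e/2 * (case z of (x, K) \<Rightarrow> Sup K - Inf K)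
                + (if z \<in> q then (case z of (x, K) \<Rightarrow> norm (?\<Delta> K)) else 0))"
      proof (rule sum_norm_le, safe)
        fix x K assume xK: "(x, K) \<in> p"
        then obtain u v where k: "K = cbox u v" and "x \<in> K"
          using ptag by blast
        then have "u \<le> v" by auto
        then have pos: "0 \<le> e/2 * (Sup K - Inf K)"
          using \<open>e > 0\<close> k by simp
        show "norm (measure lborel K *\<^sub>R g x - ?\<Delta> K) \<le> e/2 * (Sup K - Inf K)
                + (if (x, K) \<in> q then norm (?\<Delta> K) else 0)"
        proof (cases "x \<in> N")
          case True
          with xK have "(x, K) \<in> q" by (simp add: q_def)
          moreover have "g x = 0" using True by (simp add: g_def)
          ultimately show ?thesis using pos by (simp add: norm_minus_commute)
        next
          case False
          then have "(x, K) \<notin> q" by (simp add: q_def)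
          with bound[OF xK False] show ?thesis by simp
        qed
      qed
      also have "\<dots> = e/2 * (b - a) + (\<Sum>(x, K)\<in>q. norm (?\<Delta> K))"
        unfolding sum.distrib ba(1) sum_distrib_left
        using \<open>finite p\<close> q by (simp add: sum.If_cases inf.absorb2 Int_absorb1)
      also have "\<dots> \<le> e * (b - a)" using q_small by simp
      finally show "norm ((\<Sum>(x, K)\<in>p. measure lborel K *\<^sub>R g x) - (f b - f a)) \<le> e * measure lborel (cbox a b)"
        using \<open>a \<le> b\<close> by (simp add: ba(2) split_def sum_subtractf)
    qed
  qed
  then have "(g has_integral (f b - f a)) {a..b}" by simp
  then show ?thesis
    by (rule has_integral_spike[OF N, rotated]) (auto simp: g_def)
qed


section \<open>Positive semidefinite matrices\<close>

lemma norm_matrix_vector_le: "norm (M *v x) \<le> matrix_norm M * norm (x::real^'n)"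
  unfolding matrix_norm_def by (rule onorm) (simp add: matrix_vector_mul_bounded_linear)

lemma pos_semidef_self_adjoint:
  assumes "pos_semidef (M :: real^'n^'n)"
  shows "u \<bullet> (M *v v) = (M *v u) \<bullet> v"
proof -
  have "M *v u = u v* M"
    using assms transpose_matrix_vector[of M u] by (simp add: pos_semidef_def)
  then show ?thesis by (simp add: dot_lmul_matrix)
qed

text \<open>Expand the nonnegative number \<open>y \<bullet> M y\<close> for \<open>y = x - (1/c) M x\<close>.\<close>

lemma pos_semidef_norm_sq_le:
  fixes M :: "real^'n^'n"
  assumes M: "pos_semidef M" and c: "matrix_norm M \<le> c" "c > 0"
  shows "norm (M *v x) ^ 2 \<le> c * (x \<bullet> (M *v x))"
proof -
  define y where "y = M *v x"
  have "y \<bullet> (M *v y) \<le> norm y * norm (M *v y)" by (rule norm_cauchy_schwarz)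
  also have "\<dots> \<le> norm y * (c * norm y)"
    using norm_matrix_vector_le[of M y] c by (meson mult_left_mono mult_right_mono norm_ge_zero order_trans)
  finally have y: "y \<bullet> (M *v y) \<le> c * norm y ^ 2" by (simp add: power2_eq_square mult_ac)
  have "0 \<le> (x - (1/c) *\<^sub>R y) \<bullet> (M *v (x - (1/c) *\<^sub>R y))"
    using M by (simp add: pos_semidef_def)
  also have "\<dots> = x \<bullet> y - 2/c * norm y ^ 2 + (1/c)^2 * (y \<bullet> (M *v y))"
  proof -
    have "M *v (x - (1/c) *\<^sub>R y) = y - (1/c) *\<^sub>R (M *v y)"
      by (simp only: matrix_vector_mult_diff_distrib matrix_vector_mult_scaleR y_def)
    moreover have "x \<bullet> (M *v y) = norm y ^ 2"
      unfolding power2_norm_eq_inner using pos_semidef_self_adjoint[OF M, of x y] by (simp add: y_def)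
    ultimately show ?thesis
      by (simp add: inner_diff_left inner_diff_right power2_eq_square[of "1/c"]
          power2_norm_eq_inner[symmetric] right_diff_distrib)
  qed
  also have "\<dots> \<le> x \<bullet> y - 2/c * norm y ^ 2 + (1/c)^2 * (c * norm y ^ 2)"
    using y by (intro add_left_mono mult_left_mono) auto
  also have "\<dots> = x \<bullet> y - norm y ^ 2 / c"
    using c by (simp add: field_simps power2_eq_square)
  finally show ?thesis using c by (simp add: field_simps y_def)
qed

lemma matrix_quadratic_le:
  fixes M :: "real^'n^'n"
  assumes "matrix_norm M \<le> c"
  shows "x \<bullet> (M *v x) \<le> c * norm x ^ 2"
proof -
  have "x \<bullet> (M *v x) \<le> norm x * norm (M *v x)" by (rule norm_cauchy_schwarz)
  also have "\<dots> \<le> norm x * (c * norm x)"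
    using norm_matrix_vector_le[of M x] assms by (meson mult_left_mono mult_right_mono norm_ge_zero order_trans)
  finally show ?thesis by (simp add: power2_eq_square mult_ac)
qed

text \<open>The right-hand side minus the left-hand side is the quadratic form at \<open>x - 2 y\<close>.\<close>

lemma pos_semidef_quadratic_diff:
  fixes M :: "real^'n^'n"
  assumes M: "pos_semidef M" 
  shows "x \<bullet> (M *v x) \<le> 2 * (y \<bullet> (M *v y)) + 2 * ((x - y) \<bullet> (M *v (x - y)))"
proof -
  have "0 \<le> (x - 2 *\<^sub>R y) \<bullet> (M *v (x - 2 *\<^sub>R y))"
    using M by (simp add: pos_semidef_def)
  also have "\<dots> = 2 * (y \<bullet> (M *v y)) + 2 * ((x - y) \<bullet> (M *v (x - y))) - x \<bullet> (M *v x)"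
  proof -
    have "x \<bullet> (M *v y) = y \<bullet> (M *v x)"
      using pos_semidef_self_adjoint[OF M, of x y] by (simp add: inner_commute)
    then show ?thesis
      by (simp add: matrix_vector_mult_diff_distrib matrix_vector_mult_scaleR
         inner_diff_left inner_diff_right right_diff_distrib)
  qed
  finally show ?thesis by simp
qed

text \<open>Expanding the square leaves \<open>- 2 x \<bullet> B x + |B x|\<^sup>2\<close>, and \<open>|B x|\<^sup>2 \<le> x \<bullet> B x\<close>.\<close>

lemma jump_norm_sq_le:
  fixes B :: "real^'n^'n"
  assumes B: "pos_semidef B" "matrix_norm B \<le> 1"
  shows "norm ((mat 1 - B) *v x) ^ 2 \<le> norm x ^ 2 - x \<bullet> (B *v x)"
proof -
  have "norm ((mat 1 - B) *v x) ^ 2 = norm x ^ 2 - 2 * (x \<bullet> (B *v x)) + norm (B *v x) ^ 2"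
    by (simp add: matrix_vector_mult_diff_rdistrib power2_norm_eq_inner inner_diff_left inner_diff_right
        inner_commute)
  with pos_semidef_norm_sq_le[OF B, of x] show ?thesis by simp
qed

section \<open>Flow under a bounded input\<close>

lemma has_integral_le_off_finite:
  fixes f g :: "real \<Rightarrow> real"
  assumes "finite S" "(f has_integral i) T" "(g has_integral j) T"
    and "\<And>x. x \<in> T - S \<Longrightarrow> f x \<le> g x"
  shows "i \<le> j"
proof (rule has_integral_le)
  show "((\<lambda>x. if x \<in> S then g x else f x) has_integral i) T"
    by (rule has_integral_spike_finite[OF assms(1) _ assms(2)]) auto
qed (use assms in auto)

lemma norm_has_integral_le_off_finite:
  fixes f :: "real \<Rightarrow> 'a::euclidean_space"
  assumes "finite S" "(f has_integral i) T" "(g has_integral j) T"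
    and "\<And>x. x \<in> T - S \<Longrightarrow> norm (f x) \<le> g x"
  shows "norm i \<le> j"
proof -
  have f: "((\<lambda>x. if x \<in> S then 0 else f x) has_integral i) T"
    by (rule has_integral_spike_finite[OF assms(1) _ assms(2)]) auto
  have g: "((\<lambda>x. if x \<in> S then 0 else g x) has_integral j) T"
    by (rule has_integral_spike_finite[OF assms(1) _ assms(3)]) auto
  have "norm (integral T (\<lambda>x. if x \<in> S then 0 else f x)) \<le> integral T (\<lambda>x. if x \<in> S then 0 else g x)"
    using f g assms(4) by (intro integral_norm_bound_integral) (auto simp: has_integral_iff)
  then show ?thesis using f g by (simp add: has_integral_iff)
qed

text \<open>One flow interval. The generator \<open>P\<close> is continuous only up to its values at the ends, because the
  excitation signal \<open>Phi\<close> switches to \<open>B\<close> there; \<open>P'\<close> is the continuous representative that provides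
  integrability. The input is only known to be bounded; the equation itself makes it integrable.\<close>

locale perturbed_flow =
  fixes a b :: real and P P' :: "real \<Rightarrow> real^'n^'n" and \<nu> z :: "real \<Rightarrow> real^'n" and N :: real
  assumes le: "a \<le> b"
    and ac: "absolutely_continuous_fun_on {a..b} z"
    and P_int: "continuous_on {a..b} P'"  "\<And>t. t \<in> {a<..<b} \<Longrightarrow> P t = P' t"
    and psd: "\<And>t. t \<in> {a<..<b} \<Longrightarrow> pos_semidef (P t)"
    and N0: "0 \<le> N" and \<nu>: "\<And>t. t \<in> {a<..<b} \<Longrightarrow> norm (\<nu> t) \<le> N"
    and deriv: "AE t in lebesgue. t \<in> {a<..<b} \<longrightarrow>
        (z has_vector_derivative (- (P t *v z t) + \<nu> t)) (at t within {a..b})"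
begin

lemma cont: "continuous_on {a..b} z"
  by (rule absolutely_continuous_imp_continuous_on[OF ac])

definition "rhs t = - (P t *v z t) + \<nu> t"

lemma negligible_exceptional:
  assumes s: "s \<in> {a..b}"
  obtains E where "negligible E"
    "\<And>t. t \<in> {a..s} - E \<Longrightarrow> (z has_vector_derivative rhs t) (at t within {a..s})"
proof -
  obtain E where E: "\<And>t. t \<in> space lebesgue - E \<Longrightarrow> t \<in> {a<..<b} \<longrightarrow>
      (z has_vector_derivative (- (P t *v z t) + \<nu> t)) (at t within {a..b})" "E \<in> null_sets lebesgue"
    using AE_E3[OF deriv] by metis
  have "negligible (insert a (insert b E))"
    using E(2) by (simp add: negligible_iff_null_sets)
  then show ?thesis
  proof (rule that)
    fix t assume t: "t \<in> {a..s} - insert a (insert b E)"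
    then have "t \<in> {a<..<b}" using s by auto
    with t E(1)[of t] have "(z has_vector_derivative rhs t) (at t within {a..b})"
      by (simp add: rhs_def)
    then show "(z has_vector_derivative rhs t) (at t within {a..s})"
      by (rule has_vector_derivative_within_subset) (use s in auto)
  qed
qed

lemma integrable_of_P:
  fixes h :: "real \<Rightarrow> real^'n^'n \<Rightarrow> 'a::euclidean_space"
  assumes "continuous_on ({a..b} \<times> UNIV) (\<lambda>(t, M). h t M)" and s: "s \<in> {a..b}"
  shows "(\<lambda>t. h t (P t)) integrable_on {a..s}"
proof -
  have "continuous_on {a..s} ((\<lambda>(t, M). h t M) \<circ> (\<lambda>t. (t, P' t)))"
    by (rule continuous_on_compose)
       (use s in \<open>auto intro!: continuous_intros continuous_on_subset[OF P_int(1)] continuous_on_subset[OF assms(1)]\<close>)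
  then have "(\<lambda>t. h t (P' t)) integrable_on {a..s}"
    by (intro integrable_continuous_interval) (simp add: o_def)
  then show ?thesis
    by (rule integrable_spike_finite[of "{a, b}", rotated 2]) (use s P_int(2) in auto)
qed

lemma generator_integrable: "s \<in> {a..b} \<Longrightarrow> P integrable_on {a..s}"
  by (rule integrable_of_P[of "\<lambda>t M. M"]) (auto intro!: continuous_intros simp: split_def)

lemma P_vec_cont:
  assumes "continuous_on {a..b} w"
  shows "continuous_on ({a..b} \<times> UNIV) (\<lambda>(t, M). (M::real^'n^'n) *v (w t :: real^'n))"
proof -
  have w: "continuous_on ({a..b} \<times> (UNIV :: (real^'n^'n) set)) (\<lambda>x. w (fst x))"
    by (rule continuous_on_compose2[OF assms continuous_on_fst]) auto
  show ?thesis
    unfolding split_def matrix_vector_mult_def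
    by (intro continuous_on_vec_lambda continuous_on_sum continuous_on_mult continuous_on_component
        w continuous_on_snd continuous_on_id)
qed

lemma z_snd_cont: "continuous_on ({a..b} \<times> UNIV) (\<lambda>(t, M::real^'n^'n). z t)"
  unfolding split_def by (rule continuous_on_compose2[OF cont continuous_on_fst]) auto

lemma q_integrable: "s \<in> {a..b} \<Longrightarrow> (\<lambda>t. z t \<bullet> (P t *v z t)) integrable_on {a..s}"
  by (rule integrable_of_P[of "\<lambda>t M. z t \<bullet> (M *v z t)"])
     (use continuous_on_inner[OF z_snd_cont P_vec_cont[OF cont]] in \<open>auto simp: split_def\<close>)

lemma v_integrable: "s \<in> {a..b} \<Longrightarrow> (\<lambda>t. norm (P t *v z t)) integrable_on {a..s}"
  by (rule integrable_of_P[of "\<lambda>t M. norm (M *v z t)"])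
     (use continuous_on_norm[OF P_vec_cont[OF cont]] in \<open>auto simp: split_def\<close>)

lemma state_has_integral:
  assumes s: "s \<in> {a..b}"
  shows "(rhs has_integral (z s - z a)) {a..s}"
proof -
  obtain E where E: "negligible E" "\<And>t. t \<in> {a..s} - E \<Longrightarrow> (z has_vector_derivative rhs t) (at t within {a..s})"
    using negligible_exceptional[OF s] by metis
  show ?thesis
  proof (rule absolutely_continuous_ftc[OF _ _ E])
    show "absolutely_continuous_fun_on {a..s} z"
      by (rule absolutely_continuous_fun_on_subset[OF ac]) (use s in auto)
  qed (use s in auto)
qed

lemma energy_has_integral:
  assumes s: "s \<in> {a..b}"
  shows "((\<lambda>t. 2 * (z t \<bullet> rhs t)) has_integral (norm (z s) ^ 2 - norm (z a) ^ 2)) {a..s}"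
proof -
  obtain E where E: "negligible E" "\<And>t. t \<in> {a..s} - E \<Longrightarrow> (z has_vector_derivative rhs t) (at t within {a..s})"
    using negligible_exceptional[OF s] by metis
  obtain R where R: "R > 0" "\<And>t. t \<in> {a..b} \<Longrightarrow> norm (z t) \<le> R"
    using compact_imp_bounded[OF compact_continuous_image[OF cont compact_Icc]]
    unfolding bounded_pos by auto
  have "norm (z x \<bullet> z x - z y \<bullet> z y) \<le> (2 * R) * norm (z x - z y)"
    if "x \<in> {a..b}" "y \<in> {a..b}" for x y
  proof -
    have "z x \<bullet> z x - z y \<bullet> z y = (z x + z y) \<bullet> (z x - z y)"
      by (simp add: inner_add_left inner_add_right inner_diff_left inner_diff_right inner_commute)
    then have "norm (z x \<bullet> z x - z y \<bullet> z y) \<le> norm (z x + z y) * norm (z x - z y)"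
      using Cauchy_Schwarz_ineq2 by simp
    moreover have "norm (z x + z y) \<le> 2 * R"
      using norm_triangle_ineq[of "z x" "z y"] R(2)[OF that(1)] R(2)[OF that(2)] by simp
    ultimately show ?thesis by (meson mult_right_mono norm_ge_zero order_trans)
  qed
  then have "absolutely_continuous_fun_on {a..b} (\<lambda>t. z t \<bullet> z t)"
    using R(1) by (intro absolutely_continuous_fun_on_dominated[OF ac, of "2 * R"]) auto
  then have ac2: "absolutely_continuous_fun_on {a..s} (\<lambda>t. z t \<bullet> z t)"
    by (rule absolutely_continuous_fun_on_subset) (use s in auto)
  have "((\<lambda>t. z t \<bullet> z t) has_vector_derivative (2 * (z t \<bullet> rhs t))) (at t within {a..s})"
    if "t \<in> {a..s} - E" for t
    using bounded_bilinear.has_vector_derivative[OF bounded_bilinear_inner E(2)[OF that] E(2)[OF that]]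
    by (simp add: inner_commute)
  from absolutely_continuous_ftc[OF _ ac2 E(1) this] show ?thesis
    using s by (simp add: power2_norm_eq_inner)
qed

lemma energy_le:
  assumes s: "s \<in> {a..b}" and R: "\<And>t. t \<in> {a..s} \<Longrightarrow> norm (z t) \<le> R"
  shows "norm (z s) ^ 2 \<le> norm (z a) ^ 2 - 2 * integral {a..s} (\<lambda>t. z t \<bullet> (P t *v z t)) + 2 * N * R * (s - a)"
proof -
  let ?q = "\<lambda>t. z t \<bullet> (P t *v z t)"
  have "((\<lambda>t. -2 * ?q t + 2 * N * R) has_integral (-2 * integral {a..s} ?q + 2 * N * R * (s - a))) {a..s}"
    using has_integral_const_real[of "2 * N * R" a s] s q_integrable[OF s]
    by (intro has_integral_add has_integral_mult_right) (auto simp: has_integral_iff mult_ac)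
  moreover have "2 * (z t \<bullet> rhs t) \<le> -2 * ?q t + 2 * N * R" if "t \<in> {a..s} - {a, b}" for t
  proof -
    have "z t \<bullet> \<nu> t \<le> norm (z t) * norm (\<nu> t)" by (rule norm_cauchy_schwarz)
    also have "\<dots> \<le> R * N"
      using that s by (intro mult_mono R \<nu>) (auto intro: order_trans[OF norm_ge_zero R])
    finally show ?thesis by (simp add: rhs_def inner_diff_right algebra_simps)
  qed
  ultimately have "norm (z s) ^ 2 - norm (z a) ^ 2 \<le> -2 * integral {a..s} ?q + 2 * N * R * (s - a)"
    by (intro has_integral_le_off_finite[OF _ energy_has_integral[OF s], of "{a, b}"]) auto
  then show ?thesis by simp
qed

text \<open>The norm need not be differentiable where it vanishes, so the bound is read off from the energy
  inequality at a point where the norm is largest: \<open>R\<^sup>2 \<le> |z a|\<^sup>2 + 2 N R (s - a)\<close> yields the claim after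
  division by \<open>R\<close> when \<open>R > |z a|\<close>.\<close>

lemma norm_state_le:
  assumes s: "s \<in> {a..b}"
  shows "norm (z s) \<le> norm (z a) + 2 * N * (s - a)"
proof -
  obtain r where r: "r \<in> {a..s}" "\<And>t. t \<in> {a..s} \<Longrightarrow> norm (z t) \<le> norm (z r)"
    using continuous_attains_sup[of "{a..s}" "\<lambda>t. norm (z t)"] s
      continuous_on_norm[OF continuous_on_subset[OF cont, of "{a..s}"]] by auto
  define R where "R = norm (z r)"
  have rab: "r \<in> {a..b}" and Rr: "\<And>t. t \<in> {a..r} \<Longrightarrow> norm (z t) \<le> R"
    using r s by (auto simp: R_def)
  let ?q = "\<lambda>t. z t \<bullet> (P t *v z t)"
  have qi: "?q integrable_on {a..r}"
    by (rule q_integrable[OF rab])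
  have "0 \<le> integral {a..r} ?q"
    by (rule has_integral_le_off_finite[of "{a, b}" "\<lambda>t. 0" _ "{a..r}" ?q])
       (use qi rab psd in \<open>auto simp: has_integral_iff pos_semidef_def\<close>)
  with energy_le[OF rab Rr] have "R ^ 2 \<le> norm (z a) ^ 2 + 2 * N * R * (r - a)"
    by (simp add: R_def)
  also have "\<dots> \<le> norm (z a) ^ 2 + 2 * N * R * (s - a)"
    using r N0 by (intro add_left_mono mult_left_mono) (auto simp: R_def)
  finally have *: "R ^ 2 \<le> norm (z a) ^ 2 + 2 * N * R * (s - a)" .
  have "R \<le> norm (z a) + 2 * N * (s - a)"
  proof (cases "R \<le> norm (z a)")
    case True
    moreover have "0 \<le> 2 * N * (s - a)" using N0 s by simp
    ultimately show ?thesis by simp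
  next
    case False
    then have "norm (z a) ^ 2 \<le> R * norm (z a)" by (simp add: power2_eq_square mult_right_mono)
    with * have "R * R \<le> R * (norm (z a) + 2 * N * (s - a))"
      by (simp add: power2_eq_square algebra_simps)
    moreover have "R > 0" using False norm_ge_zero[of "z a"] by linarith
    ultimately show ?thesis by simp
  qed
  then show ?thesis using r(2)[of s] s by (auto simp: R_def)
qed

lemma displacement_le:
  assumes s: "s \<in> {a..b}"
  shows "norm (z s - z a) \<le> integral {a..s} (\<lambda>t. norm (P t *v z t)) + N * (s - a)"
proof -
  have "((\<lambda>t. norm (P t *v z t) + N) has_integral
      (integral {a..s} (\<lambda>t. norm (P t *v z t)) + N * (s - a))) {a..s}"
    using has_integral_const_real[of N a s] s v_integrable[OF s]
    by (intro has_integral_add) (auto simp: has_integral_iff mult_ac)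
  moreover have "norm (rhs t) \<le> norm (P t *v z t) + N" if "t \<in> {a..s} - {a, b}" for t
    using norm_triangle_ineq[of "- (P t *v z t)" "\<nu> t"] \<nu>[of t] that s by (auto simp: rhs_def)
  ultimately show ?thesis
    by (intro norm_has_integral_le_off_finite[OF _ state_has_integral[OF s], of "{a, b}"]) auto
qed

end

section \<open>The hybrid integral\<close>

definition hybrid_integrable ::
  "(nat \<Rightarrow> real) \<Rightarrow> nat \<Rightarrow> nat \<Rightarrow> 'a::euclidean_space hybrid_signal \<Rightarrow> bool" where
  "hybrid_integrable \<tau> j m g \<longleftrightarrow> (\<forall>i\<in>{j..m}. (\<lambda>s. g s i) integrable_on {\<tau> i..\<tau> (Suc i)})"

lemma hybrid_integral_same:
  "hybrid_integral \<tau> j j g = integral {\<tau> j..\<tau> (Suc j)} (\<lambda>s. g s j)"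
  by (simp add: hybrid_integral_def)

lemma hybrid_integral_Suc:
  assumes "j \<le> k"
  shows "hybrid_integral \<tau> j (Suc k) g = hybrid_integral \<tau> j k g + g (\<tau> (Suc k)) k
           + integral {\<tau> (Suc k)..\<tau> (Suc (Suc k))} (\<lambda>s. g s (Suc k))"
  using assms by (simp add: hybrid_integral_def sum.atLeastLessThan_Suc add_ac)

lemma hybrid_integral_le:
  fixes g h :: "real hybrid_signal"
  assumes "hybrid_integrable \<tau> j m g" "hybrid_integrable \<tau> j m h"
    and flow: "\<And>i t. i \<in> {j..m} \<Longrightarrow> t \<in> {\<tau> i<..<\<tau> (Suc i)} \<Longrightarrow> g t i \<le> h t i"
    and jump: "\<And>i. i \<in> {j..<m} \<Longrightarrow> g (\<tau> (Suc i)) i \<le> h (\<tau> (Suc i)) i"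
  shows "hybrid_integral \<tau> j m g \<le> hybrid_integral \<tau> j m h"
  unfolding hybrid_integral_def
proof (intro add_mono sum_mono)
  fix i assume i: "i \<in> {j..m}"
  show "integral {\<tau> i..\<tau> (Suc i)} (\<lambda>s. g s i) \<le> integral {\<tau> i..\<tau> (Suc i)} (\<lambda>s. h s i)"
  proof (rule has_integral_le_off_finite)
    show "((\<lambda>s. g s i) has_integral integral {\<tau> i..\<tau> (Suc i)} (\<lambda>s. g s i)) {\<tau> i..\<tau> (Suc i)}"
      "((\<lambda>s. h s i) has_integral integral {\<tau> i..\<tau> (Suc i)} (\<lambda>s. h s i)) {\<tau> i..\<tau> (Suc i)}"
      using assms(1,2) i by (auto simp: hybrid_integrable_def)
    show "finite {\<tau> i, \<tau> (Suc i)}" by simp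
    show "g t i \<le> h t i" if "t \<in> {\<tau> i..\<tau> (Suc i)} - {\<tau> i, \<tau> (Suc i)}" for t
      using that by (intro flow i) auto
  qed
qed (rule jump)

lemma hybrid_integral_bounded_linear:
  assumes "hybrid_integrable \<tau> j m g" "bounded_linear h"
  shows "hybrid_integral \<tau> j m (\<lambda>s i. h (g s i)) = h (hybrid_integral \<tau> j m g)"
proof -
  have "integral {\<tau> i..\<tau> (Suc i)} (\<lambda>s. h (g s i)) = h (integral {\<tau> i..\<tau> (Suc i)} (\<lambda>s. g s i))"
    if "i \<in> {j..m}" for i
    using integral_linear[OF _ assms(2), of "\<lambda>s. g s i"] assms(1) that
    by (simp add: hybrid_integrable_def o_def)
  then show ?thesis
    using bounded_linear.linear[OF assms(2)]
    by (simp add: hybrid_integral_def linear_add linear_sum)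
qed

lemma hybrid_integrable_affine:
  fixes g :: "real hybrid_signal"
  assumes "hybrid_integrable \<tau> j m g"
  shows "hybrid_integrable \<tau> j m (\<lambda>s i. \<alpha> + \<beta> * g s i)"
  unfolding hybrid_integrable_def
proof
  fix i assume "i \<in> {j..m}"
  then have "(\<lambda>s. g s i) integrable_on {\<tau> i..\<tau> (Suc i)}" using assms by (simp add: hybrid_integrable_def)
  then show "(\<lambda>s. \<alpha> + \<beta> * g s i) integrable_on {\<tau> i..\<tau> (Suc i)}"
    by (intro integrable_add integrable_const_ivl integrable_on_mult_right)
qed

lemma hybrid_integral_affine:
  fixes g :: "real hybrid_signal"
  assumes g: "hybrid_integrable \<tau> j m g" and jm: "j \<le> m"
    and mono: "\<And>i. i \<in> {j..m} \<Longrightarrow> \<tau> i \<le> \<tau> (Suc i)"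
  shows "hybrid_integral \<tau> j m (\<lambda>s i. \<alpha> + \<beta> * g s i)
           = \<alpha> * (\<tau> (Suc m) - \<tau> j + (real m - real j)) + \<beta> * hybrid_integral \<tau> j m g"
proof -
  have "integral {\<tau> i..\<tau> (Suc i)} (\<lambda>s. \<alpha> + \<beta> * g s i)
      = \<alpha> * (\<tau> (Suc i) - \<tau> i) + \<beta> * integral {\<tau> i..\<tau> (Suc i)} (\<lambda>s. g s i)"
    if i: "i \<in> {j..m}" for i
  proof -
    have "((\<lambda>s. \<alpha> + \<beta> * g s i) has_integral
        (\<alpha> * (\<tau> (Suc i) - \<tau> i) + \<beta> * integral {\<tau> i..\<tau> (Suc i)} (\<lambda>s. g s i))) {\<tau> i..\<tau> (Suc i)}"
      using has_integral_const_real[of \<alpha> "\<tau> i" "\<tau> (Suc i)"] g mono[OF i] i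
      by (intro has_integral_add has_integral_mult_right) (auto simp: hybrid_integrable_def mult_ac)
    then show ?thesis by (simp add: has_integral_iff)
  qed
  then have "(\<Sum>i\<in>{j..m}. integral {\<tau> i..\<tau> (Suc i)} (\<lambda>s. \<alpha> + \<beta> * g s i))
      = \<alpha> * (\<Sum>i\<in>{j..m}. \<tau> (Suc i) - \<tau> i) + \<beta> * (\<Sum>i\<in>{j..m}. integral {\<tau> i..\<tau> (Suc i)} (\<lambda>s. g s i))"
    by (simp add: sum.distrib sum_distrib_left)
  then have "hybrid_integral \<tau> j m (\<lambda>s i. \<alpha> + \<beta> * g s i) =
      \<alpha> * (\<Sum>i\<in>{j..m}. \<tau> (Suc i) - \<tau> i) + \<alpha> * (real m - real j) + \<beta> * hybrid_integral \<tau> j m g"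
    using jm by (simp add: hybrid_integral_def sum.distrib sum_distrib_left algebra_simps of_nat_diff)
  also have "(\<Sum>i\<in>{j..m}. \<tau> (Suc i) - \<tau> i) = \<tau> (Suc m) - \<tau> j"
    using sum_Suc_diff[of j m \<tau>] jm by simp
  finally show ?thesis by (simp add: algebra_simps)
qed

section \<open>Trajectories along a hybrid path\<close>

text \<open>A trajectory over a compact hybrid time domain. A single signal \<open>P\<close> serves both as the generator of
  the flows and as the matrix of the jumps, so that all estimates are hybrid integrals of \<open>P\<close>.\<close>

locale perturbed_path =
  fixes \<tau> :: "nat \<Rightarrow> real" and j m :: nat
    and A P :: "(real^'n^'n) hybrid_signal" and \<nu> \<zeta> :: "(real^'n) hybrid_signal" and c N :: real
  assumes jm: "j \<le> m"
    and mono: "\<And>i. i \<in> {j..m} \<Longrightarrow> \<tau> i \<le> \<tau> (Suc i)"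
    and arc: "\<And>i. i \<in> {j..m} \<Longrightarrow> absolutely_continuous_fun_on {\<tau> i..\<tau> (Suc i)} (\<lambda>t. \<zeta> t i)"
    and A_cont: "\<And>i. i \<in> {j..m} \<Longrightarrow> continuous_on {\<tau> i..\<tau> (Suc i)} (\<lambda>t. A t i)"
    and P_flow: "\<And>i t. i \<in> {j..m} \<Longrightarrow> t \<in> {\<tau> i<..<\<tau> (Suc i)} \<Longrightarrow> P t i = A t i"
    and psd_flow: "\<And>i t. i \<in> {j..m} \<Longrightarrow> t \<in> {\<tau> i<..<\<tau> (Suc i)} \<Longrightarrow>
          pos_semidef (P t i) \<and> matrix_norm (P t i) \<le> c"
    and psd_jump: "\<And>i. i \<in> {j..<m} \<Longrightarrow>
          pos_semidef (P (\<tau> (Suc i)) i) \<and> matrix_norm (P (\<tau> (Suc i)) i) \<le> 1"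
    and c1: "1 \<le> c"
    and N0: "0 \<le> N"
    and \<nu>_flow: "\<And>i t. i \<in> {j..m} \<Longrightarrow> t \<in> {\<tau> i<..<\<tau> (Suc i)} \<Longrightarrow> norm (\<nu> t i) \<le> N"
    and \<nu>_jump: "\<And>i. i \<in> {j..<m} \<Longrightarrow> norm (\<nu> (\<tau> (Suc i)) i) \<le> N"
    and flow: "\<And>i. i \<in> {j..m} \<Longrightarrow> AE t in lebesgue. t \<in> {\<tau> i<..<\<tau> (Suc i)} \<longrightarrow>
          ((\<lambda>s. \<zeta> s i) has_vector_derivative (- (P t i *v \<zeta> t i) + \<nu> t i)) (at t within {\<tau> i..\<tau> (Suc i)})"
    and jump: "\<And>i. i \<in> {j..<m} \<Longrightarrow>
          \<zeta> (\<tau> (Suc i)) (Suc i) = (mat 1 - P (\<tau> (Suc i)) i) *v \<zeta> (\<tau> (Suc i)) i + \<nu> (\<tau> (Suc i)) i"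
begin

lemma times_mono:
  assumes "i \<le> k" "j \<le> i" "k \<le> m"
  shows "\<tau> (Suc i) \<le> \<tau> (Suc k)"
  using assms
proof (induction k rule: dec_induct)
  case (step k)
  then show ?case using mono[of "Suc k"] by simp
qed simp

lemma flow_piece:
  "i \<in> {j..m} \<Longrightarrow>
    perturbed_flow (\<tau> i) (\<tau> (Suc i)) (\<lambda>t. P t i) (\<lambda>t. A t i) (\<lambda>t. \<nu> t i) (\<lambda>t. \<zeta> t i) N"
  by unfold_locales (use mono arc A_cont P_flow psd_flow N0 \<nu>_flow flow in auto)

abbreviation "z0 \<equiv> \<zeta> (\<tau> j) j"

definition "len k = \<tau> (Suc k) - \<tau> j + (real k - real j)"

text \<open>The rate of dissipation, and the part of the speed of the state that is not due to the input.\<close>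

definition "q t i = \<zeta> t i \<bullet> (P t i *v \<zeta> t i)"
definition "v t i = norm (P t i *v \<zeta> t i)"

lemma hybrid_integrable_signals:
  assumes "k \<le> m"
  shows q_integrable: "hybrid_integrable \<tau> j k q" and v_integrable: "hybrid_integrable \<tau> j k v"
    and P_integrable: "hybrid_integrable \<tau> j k P"
proof -
  have i: "i \<in> {j..m}" "\<tau> (Suc i) \<in> {\<tau> i..\<tau> (Suc i)}" if "i \<in> {j..k}" for i
    using that assms mono[of i] by auto
  show "hybrid_integrable \<tau> j k q" "hybrid_integrable \<tau> j k v" "hybrid_integrable \<tau> j k P"
    unfolding hybrid_integrable_def q_def v_def
    using perturbed_flow.q_integrable[OF flow_piece[OF i(1)] i(2)]
      perturbed_flow.v_integrable[OF flow_piece[OF i(1)] i(2)]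
      perturbed_flow.generator_integrable[OF flow_piece[OF i(1)] i(2)] by auto
qed

lemma norm_jump_le:
  assumes i: "i \<in> {j..<m}"
  shows "norm (\<zeta> (\<tau> (Suc i)) (Suc i)) \<le> norm (\<zeta> (\<tau> (Suc i)) i) + N"
proof -
  let ?B = "P (\<tau> (Suc i)) i" and ?x = "\<zeta> (\<tau> (Suc i)) i"
  have B: "pos_semidef ?B" "matrix_norm ?B \<le> 1" using psd_jump[OF i] by auto
  have "norm ((mat 1 - ?B) *v ?x) ^ 2 \<le> norm ?x ^ 2"
    using jump_norm_sq_le[OF B, of ?x] B(1) by (simp add: pos_semidef_def add.commute order_trans[of _ "_ - _"])
  then have "norm ((mat 1 - ?B) *v ?x) \<le> norm ?x" by (rule power2_le_imp_le) simp
  with \<nu>_jump[OF i] jump[OF i] show ?thesis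
    using norm_triangle_ineq[of "(mat 1 - ?B) *v ?x" "\<nu> (\<tau> (Suc i)) i"] by simp
qed

lemma norm_le:
  assumes "k \<in> {j..m}" "t \<in> {\<tau> k..\<tau> (Suc k)}"
  shows "norm (\<zeta> t k) \<le> norm z0 + 2 * N * (t - \<tau> j + (real k - real j))"
proof -
  have "j \<le> k" "k \<le> m" using assms by auto
  then have "\<forall>t\<in>{\<tau> k..\<tau> (Suc k)}. norm (\<zeta> t k) \<le> norm z0 + 2 * N * (t - \<tau> j + (real k - real j))"
  proof (induction k rule: dec_induct)
    case base
    show ?case
      using perturbed_flow.norm_state_le[OF flow_piece, of j] jm by auto
  next
    case (step k)
    have k: "k \<in> {j..<m}" "Suc k \<in> {j..m}" "k \<in> {j..m}" using step by auto
    have "norm (\<zeta> (\<tau> (Suc k)) k) \<le> norm z0 + 2 * N * (\<tau> (Suc k) - \<tau> j + (real k - real j))"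
      using step mono[OF k(3)] by auto
    with norm_jump_le[OF k(1)] N0
    have *: "norm (\<zeta> (\<tau> (Suc k)) (Suc k)) \<le> norm z0 + 2 * N * (\<tau> (Suc k) - \<tau> j + (real (Suc k) - real j))"
      by (simp add: algebra_simps)
    show ?case
    proof
      fix t assume "t \<in> {\<tau> (Suc k)..\<tau> (Suc (Suc k))}"
      with perturbed_flow.norm_state_le[OF flow_piece[OF k(2)], of t] *
      show "norm (\<zeta> t (Suc k)) \<le> norm z0 + 2 * N * (t - \<tau> j + (real (Suc k) - real j))"
        by (simp add: algebra_simps)
    qed
  qed
  then show ?thesis using assms by auto
qed

lemma q_nonneg:
  "i \<in> {j..m} \<Longrightarrow> t \<in> {\<tau> i<..<\<tau> (Suc i)} \<Longrightarrow> 0 \<le> q t i"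
  "i \<in> {j..<m} \<Longrightarrow> 0 \<le> q (\<tau> (Suc i)) i"
  using psd_flow psd_jump by (auto simp: q_def pos_semidef_def)

lemma integral_q_nonneg:
  assumes i: "i \<in> {j..m}"
  shows "0 \<le> integral {\<tau> i..\<tau> (Suc i)} (\<lambda>t. q t i)"
  by (rule has_integral_le_off_finite[of "{\<tau> i, \<tau> (Suc i)}" "\<lambda>t. 0" _ "{\<tau> i..\<tau> (Suc i)}" "\<lambda>t. q t i"])
     (use q_integrable[of m] i in \<open>auto simp: hybrid_integrable_def intro: q_nonneg\<close>)

lemma dissipation_nonneg: "0 \<le> hybrid_integral \<tau> j m q"
  using integral_q_nonneg q_nonneg(2) unfolding hybrid_integral_def
  by (intro add_nonneg_nonneg sum_nonneg) auto

lemma energy_jump_le: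
  assumes i: "i \<in> {j..<m}" and R: "norm (\<zeta> (\<tau> (Suc i)) i) \<le> R"
  shows "norm (\<zeta> (\<tau> (Suc i)) (Suc i)) ^ 2
           \<le> norm (\<zeta> (\<tau> (Suc i)) i) ^ 2 - q (\<tau> (Suc i)) i + (2 * N * R + N ^ 2)"
proof -
  let ?B = "P (\<tau> (Suc i)) i" and ?x = "\<zeta> (\<tau> (Suc i)) i"
  define y where "y = norm ((mat 1 - ?B) *v ?x)"
  have B: "pos_semidef ?B" "matrix_norm ?B \<le> 1" using psd_jump[OF i] by auto
  have y2: "y ^ 2 \<le> norm ?x ^ 2 - q (\<tau> (Suc i)) i"
    using jump_norm_sq_le[OF B, of ?x] by (simp add: q_def y_def)
  then have "y ^ 2 \<le> norm ?x ^ 2" using q_nonneg(2)[OF i] by linarith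
  then have "y \<le> norm ?x" by (rule power2_le_imp_le) simp
  then have yR: "y \<le> R" using R by simp
  have "norm (\<zeta> (\<tau> (Suc i)) (Suc i)) \<le> y + N"
    using \<nu>_jump[OF i] jump[OF i] norm_triangle_ineq[of "(mat 1 - ?B) *v ?x" "\<nu> (\<tau> (Suc i)) i"]
    by (simp add: y_def)
  then have "norm (\<zeta> (\<tau> (Suc i)) (Suc i)) ^ 2 \<le> (y + N) ^ 2" by (intro power_mono) auto
  also have "\<dots> = y ^ 2 + 2 * N * y + N ^ 2" by (simp add: power2_sum)
  also have "2 * N * y \<le> 2 * N * R" using yR N0 by (intro mult_left_mono) auto
  finally show ?thesis using y2 by linarith
qed

lemma energy_le:
  assumes "k \<in> {j..m}"
    and R: "\<And>i t. i \<in> {j..m} \<Longrightarrow> t \<in> {\<tau> i..\<tau> (Suc i)} \<Longrightarrow> norm (\<zeta> t i) \<le> R"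
  shows "norm (\<zeta> (\<tau> (Suc k)) k) ^ 2 \<le> norm z0 ^ 2 - hybrid_integral \<tau> j k q + (2 * N * R + N ^ 2) * len k"
proof -
  have piece: "norm (\<zeta> (\<tau> (Suc i)) i) ^ 2 \<le> norm (\<zeta> (\<tau> i) i) ^ 2
      - integral {\<tau> i..\<tau> (Suc i)} (\<lambda>t. q t i) + (2 * N * R + N ^ 2) * (\<tau> (Suc i) - \<tau> i)"
    if i: "i \<in> {j..m}" for i
  proof -
    have "norm (\<zeta> (\<tau> (Suc i)) i) ^ 2 \<le> norm (\<zeta> (\<tau> i) i) ^ 2
       - 2 * integral {\<tau> i..\<tau> (Suc i)} (\<lambda>t. q t i) + 2 * N * R * (\<tau> (Suc i) - \<tau> i)"
      unfolding q_def by (rule perturbed_flow.energy_le[OF flow_piece[OF i]]) (use R i mono[OF i] in auto)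
    moreover have "2 * N * R * (\<tau> (Suc i) - \<tau> i) \<le> (2 * N * R + N ^ 2) * (\<tau> (Suc i) - \<tau> i)"
      using mono[OF i] by (intro mult_right_mono) auto
    (* Half of the dissipation of the flow is given away, so that flows and jumps count alike. *)
    ultimately show ?thesis using integral_q_nonneg[OF i] by linarith
  qed
  have "j \<le> k" "k \<le> m" using assms by auto
  then show ?thesis
  proof (induction k rule: dec_induct)
    case base
    then show ?case using piece[of j] by (simp add: hybrid_integral_same len_def)
  next
    case (step k)
    have k: "k \<in> {j..<m}" "Suc k \<in> {j..m}" "k \<in> {j..m}" using step by auto
    have "norm (\<zeta> (\<tau> (Suc k)) k) \<le> R" using R[OF k(3)] mono[OF k(3)] by auto
    from energy_jump_le[OF k(1) this] piece[OF k(2)] step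
    have "norm (\<zeta> (\<tau> (Suc (Suc k))) (Suc k)) ^ 2 \<le> norm z0 ^ 2 - hybrid_integral \<tau> j (Suc k) q
       + ((2 * N * R + N ^ 2) * len k + (2 * N * R + N ^ 2) + (2 * N * R + N ^ 2) * (\<tau> (Suc (Suc k)) - \<tau> (Suc k)))"
      using hybrid_integral_Suc[OF step(1), of \<tau> q] by linarith
    also have "(2 * N * R + N ^ 2) * len k + (2 * N * R + N ^ 2) + (2 * N * R + N ^ 2) * (\<tau> (Suc (Suc k)) - \<tau> (Suc k))
       = (2 * N * R + N ^ 2) * len (Suc k)"
      by (simp add: len_def algebra_simps)
    finally show ?case .
  qed
qed

lemma integral_v_mono:
  assumes i: "i \<in> {j..m}" and t: "t \<in> {\<tau> i..\<tau> (Suc i)}"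
  shows "0 \<le> integral {\<tau> i..t} (\<lambda>t. v t i)"
    "integral {\<tau> i..t} (\<lambda>t. v t i) \<le> integral {\<tau> i..\<tau> (Suc i)} (\<lambda>t. v t i)"
proof -
  have vi: "(\<lambda>t. v t i) integrable_on {\<tau> i..\<tau> (Suc i)}"
    using v_integrable[of m] i by (auto simp: hybrid_integrable_def)
  moreover have "(\<lambda>t. v t i) integrable_on {\<tau> i..t}"
    by (rule integrable_on_subinterval[OF vi]) (use t in auto)
  ultimately show "0 \<le> integral {\<tau> i..t} (\<lambda>t. v t i)"
    "integral {\<tau> i..t} (\<lambda>t. v t i) \<le> integral {\<tau> i..\<tau> (Suc i)} (\<lambda>t. v t i)"
    using t by (auto intro!: integral_nonneg integral_subset_le simp: v_def)
qed

text \<open>The generator and the input move the state separately; summing over the pieces bounds the distance from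
  \<open>z0\<close> at every point of the path by totals over the whole path.\<close>

lemma displacement_le:
  assumes "k \<in> {j..m}"
  shows "\<forall>i\<in>{j..k}. \<forall>t\<in>{\<tau> i..\<tau> (Suc i)}. norm (\<zeta> t i - z0) \<le> hybrid_integral \<tau> j k v + N * len k"
proof -
  have piece: "norm (\<zeta> t i - \<zeta> (\<tau> i) i) \<le> integral {\<tau> i..\<tau> (Suc i)} (\<lambda>t. v t i) + N * (\<tau> (Suc i) - \<tau> i)"
    if i: "i \<in> {j..m}" and t: "t \<in> {\<tau> i..\<tau> (Suc i)}" for i t
  proof -
    have "norm (\<zeta> t i - \<zeta> (\<tau> i) i) \<le> integral {\<tau> i..t} (\<lambda>t. v t i) + N * (t - \<tau> i)"
      unfolding v_def by (rule perturbed_flow.displacement_le[OF flow_piece[OF i] t])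
    moreover have "N * (t - \<tau> i) \<le> N * (\<tau> (Suc i) - \<tau> i)"
      using t N0 by (intro mult_left_mono) auto
    ultimately show ?thesis using integral_v_mono(2)[OF i t] by linarith
  qed
  have "j \<le> k" "k \<le> m" using assms by auto
  then show ?thesis
  proof (induction k rule: dec_induct)
    case base
    then show ?case using piece[of j] by (auto simp: hybrid_integral_same len_def)
  next
    case (step k)
    have k: "k \<in> {j..<m}" "Suc k \<in> {j..m}" "k \<in> {j..m}" using step by auto
    let ?x = "\<zeta> (\<tau> (Suc k)) k" and ?y = "\<zeta> (\<tau> (Suc k)) (Suc k)"
    let ?v' = "v (\<tau> (Suc k)) k" and ?I = "integral {\<tau> (Suc k)..\<tau> (Suc (Suc k))} (\<lambda>t. v t (Suc k))"
    have HI: "hybrid_integral \<tau> j (Suc k) v = hybrid_integral \<tau> j k v + ?v' + ?I"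
      by (rule hybrid_integral_Suc[OF step(1)])
    have len: "N * len (Suc k) = N * len k + N + N * (\<tau> (Suc (Suc k)) - \<tau> (Suc k))"
      by (simp add: len_def algebra_simps)
    have I: "0 \<le> ?I" using integral_v_mono(1)[OF k(2)] mono[OF k(2)] by auto
    have v': "0 \<le> ?v'" by (simp add: v_def)
    have grow: "0 \<le> N * (\<tau> (Suc (Suc k)) - \<tau> (Suc k))" using N0 mono[OF k(2)] by simp
    have IH: "norm (\<zeta> t i - z0) \<le> hybrid_integral \<tau> j k v + N * len k"
      if "i \<in> {j..k}" "t \<in> {\<tau> i..\<tau> (Suc i)}" for i t
      using step that by auto
    have x: "norm (?x - z0) \<le> hybrid_integral \<tau> j k v + N * len k"
      using mono[OF k(3)] step by (intro IH) auto
    have "?y - ?x = - (P (\<tau> (Suc k)) k *v ?x) + \<nu> (\<tau> (Suc k)) k"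
      using jump[OF k(1)] by (simp add: matrix_vector_mult_diff_rdistrib)
    then have yx: "norm (?y - ?x) \<le> ?v' + N"
      using norm_triangle_ineq[of "- (P (\<tau> (Suc k)) k *v ?x)" "\<nu> (\<tau> (Suc k)) k"] \<nu>_jump[OF k(1)]
      by (simp add: v_def)
    show ?case
    proof (intro ballI)
      fix i t assume i: "i \<in> {j..Suc k}" and t: "t \<in> {\<tau> i..\<tau> (Suc i)}"
      show "norm (\<zeta> t i - z0) \<le> hybrid_integral \<tau> j (Suc k) v + N * len (Suc k)"
      proof (cases "i = Suc k")
        case False
        then have "norm (\<zeta> t i - z0) \<le> hybrid_integral \<tau> j k v + N * len k"
          using i t by (intro IH) auto
        then show ?thesis unfolding HI len using I v' grow N0 by linarith
      next
        case True
        have "\<zeta> t i - z0 = (\<zeta> t (Suc k) - ?y) + (?y - ?x) + (?x - z0)" using True by simp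
        then have "norm (\<zeta> t i - z0) = norm ((\<zeta> t (Suc k) - ?y) + (?y - ?x) + (?x - z0))"
          by (rule arg_cong)
        then have "norm (\<zeta> t i - z0) \<le> norm (\<zeta> t (Suc k) - ?y) + norm (?y - ?x) + norm (?x - z0)"
          using norm_triangle_ineq[of "\<zeta> t (Suc k) - ?y + (?y - ?x)" "?x - z0"]
            norm_triangle_ineq[of "\<zeta> t (Suc k) - ?y" "?y - ?x"] by linarith
        moreover have "norm (\<zeta> t (Suc k) - ?y) \<le> ?I + N * (\<tau> (Suc (Suc k)) - \<tau> (Suc k))"
          using t True by (intro piece k) auto
        ultimately show ?thesis unfolding HI len using x yx by linarith
      qed
    qed
  qed
qed

lemma v_sq_le:
  "i \<in> {j..m} \<Longrightarrow> t \<in> {\<tau> i<..<\<tau> (Suc i)} \<Longrightarrow> v t i ^ 2 \<le> c * q t i"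
  "i \<in> {j..<m} \<Longrightarrow> v (\<tau> (Suc i)) i ^ 2 \<le> c * q (\<tau> (Suc i)) i"
  unfolding v_def q_def
  using psd_flow[of i t] psd_jump[of i] c1 by (auto intro!: pos_semidef_norm_sq_le)

text \<open>The Cauchy-Schwarz inequality for the hybrid integral: pointwise \<open>v \<le> \<eta>/2 + v\<^sup>2/(2\<eta>)\<close>, integrated and
  optimised over \<open>\<eta>\<close>, with \<open>v\<^sup>2 \<le> c q\<close>.\<close>

lemma total_variation_sq_le:
  assumes len: "0 < len m"
  shows "hybrid_integral \<tau> j m v ^ 2 \<le> c * len m * hybrid_integral \<tau> j m q"
proof -
  let ?F = "hybrid_integral \<tau> j m v" and ?D = "hybrid_integral \<tau> j m q"
  note D = dissipation_nonneg
  have F: "?F \<le> \<eta> / 2 * len m + c / (2 * \<eta>) * ?D" if \<eta>: "\<eta> > 0" for \<eta>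
  proof -
    have *: "x \<le> \<eta> / 2 + c / (2 * \<eta>) * y" if "x ^ 2 \<le> c * y" for x y
    proof -
      have "0 \<le> (x - \<eta>) ^ 2" by simp
      then have "2 * \<eta> * x \<le> \<eta> ^ 2 + c * y"
        using that by (simp add: power2_diff algebra_simps)
      then show ?thesis using \<eta> by (simp add: field_simps power2_eq_square)
    qed
    have int: "hybrid_integrable \<tau> j m (\<lambda>s i. \<eta> / 2 + c / (2 * \<eta>) * q s i)"
      by (intro hybrid_integrable_affine q_integrable order_refl)
    have "?F \<le> hybrid_integral \<tau> j m (\<lambda>s i. \<eta> / 2 + c / (2 * \<eta>) * q s i)"
      by (intro hybrid_integral_le v_integrable int * v_sq_le order_refl)
    also have "\<dots> = \<eta> / 2 * len m + c / (2 * \<eta>) * ?D"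
      unfolding len_def by (rule hybrid_integral_affine[OF q_integrable[OF order_refl] jm mono])
    finally show ?thesis .
  qed
  show ?thesis
  proof (cases "?F > 0")
    case True
    (* The weight is chosen so that the first summand of the bound is half of the left-hand side. *)
    have "?F \<le> ?F / 2 + c / (2 * (?F / len m)) * ?D"
      using F[of "?F / len m"] True len by simp
    then have "?F / 2 \<le> c / (2 * (?F / len m)) * ?D" by linarith
    then show ?thesis using True len by (simp add: field_simps power2_eq_square)
  next
    case False
    have "0 \<le> ?F"
      using integral_v_mono(1) mono unfolding hybrid_integral_def
      by (intro add_nonneg_nonneg sum_nonneg) (auto simp: v_def)
    with False have "?F = 0" by simp
    then show ?thesis using D len c1 by simp
  qed
qed

text \<open>The heart of the matter: excitation is an assumption on \<open>P\<close> along a frozen vector, and dissipation is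
  measured along the moving state. The two differ by at most the displacement of the state, which is itself
  controlled by the dissipation.\<close>

lemma excitation_le_dissipation:
  assumes pe: "loewner_le (\<mu> *\<^sub>R mat 1) (hybrid_integral \<tau> j m P)"
    and len: "0 < len m" "len m \<le> H"
  shows "\<mu> * norm z0 ^ 2 \<le> (2 + 4 * c ^ 2 * H ^ 2) * hybrid_integral \<tau> j m q + 4 * c * H ^ 3 * N ^ 2"
proof -
  let ?F = "hybrid_integral \<tau> j m v" and ?D = "hybrid_integral \<tau> j m q"
  define \<delta> where "\<delta> = ?F + N * len m"
  note D = dissipation_nonneg
  have \<delta>: "norm (z0 - \<zeta> t i) \<le> \<delta>" if "i \<in> {j..m}" "t \<in> {\<tau> i..\<tau> (Suc i)}" for i t
    using displacement_le[of m] jm that by (auto simp: \<delta>_def norm_minus_commute)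
  have quad: "z0 \<bullet> (P t i *v z0) \<le> 2 * c * \<delta> ^ 2 + 2 * q t i"
    if i: "i \<in> {j..m}" "t \<in> {\<tau> i..\<tau> (Suc i)}" and P: "pos_semidef (P t i)" "matrix_norm (P t i) \<le> c" for i t
  proof -
    have "(z0 - \<zeta> t i) \<bullet> (P t i *v (z0 - \<zeta> t i)) \<le> c * norm (z0 - \<zeta> t i) ^ 2"
      by (rule matrix_quadratic_le[OF P(2)])
    also have "\<dots> \<le> c * \<delta> ^ 2"
      using \<delta>[OF i] c1 by (intro mult_left_mono power_mono) auto
    finally show ?thesis
      using pos_semidef_quadratic_diff[OF P(1), of z0 "\<zeta> t i"] by (simp add: q_def)
  qed
  have bl: "bounded_linear (\<lambda>M::real^'n^'n. z0 \<bullet> (M *v z0))"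
    unfolding linear_conv_bounded_linear[symmetric]
    by (rule linearI) (simp_all add: matrix_vector_mult_add_rdistrib inner_add_right
        scaleR_matrix_vector_assoc[symmetric])
  have int: "hybrid_integrable \<tau> j m (\<lambda>s i. z0 \<bullet> (P s i *v z0))"
    using P_integrable[OF order_refl] integrable_linear[OF _ bl] unfolding hybrid_integrable_def o_def by auto
  have int2: "hybrid_integrable \<tau> j m (\<lambda>s i. 2 * c * \<delta> ^ 2 + 2 * q s i)"
    by (intro hybrid_integrable_affine q_integrable order_refl)
  have "\<mu> * norm z0 ^ 2 \<le> z0 \<bullet> (hybrid_integral \<tau> j m P *v z0)"
    using pe unfolding loewner_le_def pos_semidef_def
    by (simp add: matrix_vector_mult_diff_rdistrib inner_diff_right power2_norm_eq_inner
        scaleR_matrix_vector_assoc[symmetric])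
  also have "\<dots> = hybrid_integral \<tau> j m (\<lambda>s i. z0 \<bullet> (P s i *v z0))"
    by (rule hybrid_integral_bounded_linear[OF P_integrable[OF order_refl] bl, symmetric])
  also have "\<dots> \<le> hybrid_integral \<tau> j m (\<lambda>s i. 2 * c * \<delta> ^ 2 + 2 * q s i)"
  proof (rule hybrid_integral_le[OF int int2])
    fix i t assume "i \<in> {j..m}" "t \<in> {\<tau> i<..<\<tau> (Suc i)}"
    then show "z0 \<bullet> (P t i *v z0) \<le> 2 * c * \<delta> ^ 2 + 2 * q t i"
      using psd_flow by (intro quad) auto
  next
    fix i assume i: "i \<in> {j..<m}"
    then show "z0 \<bullet> (P (\<tau> (Suc i)) i *v z0) \<le> 2 * c * \<delta> ^ 2 + 2 * q (\<tau> (Suc i)) i"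
      using psd_jump[OF i] c1 mono[of i] by (intro quad) auto
  qed
  also have "\<dots> = 2 * c * \<delta> ^ 2 * len m + 2 * ?D"
    unfolding len_def by (rule hybrid_integral_affine[OF q_integrable[OF order_refl] jm mono])
  also have "2 * c * \<delta> ^ 2 * len m \<le> 2 * c * (2 * c * H * ?D + 2 * N ^ 2 * H ^ 2) * H"
  proof (intro mult_mono mult_left_mono)
    have "\<delta> ^ 2 \<le> 2 * ?F ^ 2 + 2 * (N * len m) ^ 2"
      using sum_squares_bound[of ?F "N * len m"] by (simp add: \<delta>_def power2_sum)
    also have "\<dots> \<le> 2 * (c * H * ?D) + 2 * (N * H) ^ 2"
    proof (intro add_mono mult_left_mono power_mono)
      have "c * len m * ?D \<le> c * H * ?D"
        using D c1 len by (intro mult_right_mono mult_left_mono) auto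
      then show "?F ^ 2 \<le> c * H * ?D" using total_variation_sq_le[OF len(1)] by linarith
    qed (use N0 len in auto)
    finally show "\<delta> ^ 2 \<le> 2 * c * H * ?D + 2 * N ^ 2 * H ^ 2"
      by (simp add: power_mult_distrib mult_ac)
  qed (use c1 len D in auto)
  finally show ?thesis by (simp add: algebra_simps power2_eq_square power3_eq_cube)
qed

text \<open>The relation between dissipation and \<open>z0\<close> turns the energy inequality into a contraction by
  \<open>1 - \<mu>/G\<close>; half of the gain absorbs the mixed term in \<open>|z0|\<close> and \<open>N\<close>.\<close>

lemma window_contraction:
  assumes pe: "loewner_le (\<mu> *\<^sub>R mat 1) (hybrid_integral \<tau> j m P)" and \<mu>: "\<mu> > 0"
    and len: "0 < len m" "len m \<le> H"
    and G: "G = 2 + 4 * c ^ 2 * H ^ 2"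
  shows "norm (\<zeta> (\<tau> (Suc m)) m) ^ 2 \<le> (1 - \<mu> / (2 * G)) * norm z0 ^ 2
           + (4 * c * H ^ 3 / G + 4 * H ^ 2 + H + 2 * G * H ^ 2 / \<mu>) * N ^ 2"
proof -
  let ?D = "hybrid_integral \<tau> j m q"
  define R where "R = norm z0 + 2 * N * H"
  have "G > 0" unfolding G by (simp add: add_pos_nonneg)
  have R: "norm (\<zeta> t i) \<le> R" if "i \<in> {j..m}" "t \<in> {\<tau> i..\<tau> (Suc i)}" for i t
  proof -
    have "i \<le> m" "j \<le> i" using that by auto
    then have "\<tau> (Suc i) \<le> \<tau> (Suc m)"
      by (rule times_mono) (rule order_refl)
    then have "t - \<tau> j + (real i - real j) \<le> H"
      using len(2) that by (auto simp: len_def)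
    then have "2 * N * (t - \<tau> j + (real i - real j)) \<le> 2 * N * H"
      using N0 by (intro mult_left_mono) auto
    with norm_le[OF that] show ?thesis by (simp add: R_def)
  qed
  have "norm (\<zeta> (\<tau> (Suc m)) m) ^ 2 \<le> norm z0 ^ 2 - ?D + (2 * N * R + N ^ 2) * len m"
    by (rule energy_le) (use jm R in auto)
  also have "(2 * N * R + N ^ 2) * len m \<le> (2 * N * R + N ^ 2) * H"
    using len N0 by (intro mult_left_mono) (auto simp: R_def intro!: add_nonneg_nonneg mult_nonneg_nonneg)
  also have "(2 * N * R + N ^ 2) * H = 2 * (norm z0 * (N * H)) + (4 * H ^ 2 + H) * N ^ 2"
    by (simp add: R_def algebra_simps power2_eq_square)
  (* Young's inequality, weighted so that half of the decay absorbs the square of the initial norm. *)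
  also have "2 * (norm z0 * (N * H)) \<le> \<mu> / (2 * G) * norm z0 ^ 2 + 2 * G * H ^ 2 / \<mu> * N ^ 2"
  proof -
    define k where "k = \<mu> / (2 * G)"
    have k: "k > 0" using \<mu> \<open>G > 0\<close> by (simp add: k_def)
    have "0 \<le> (k * norm z0 - N * H) ^ 2 / k" using k by simp
    also have "\<dots> = k * norm z0 ^ 2 - 2 * (norm z0 * (N * H)) + H ^ 2 / k * N ^ 2"
      using k by (simp add: power2_eq_square field_simps)
    finally have "2 * (norm z0 * (N * H)) \<le> k * norm z0 ^ 2 + H ^ 2 / k * N ^ 2" by simp
    moreover have "H ^ 2 / k = 2 * G * H ^ 2 / \<mu>" using \<mu> \<open>G > 0\<close> by (simp add: k_def field_simps)
    ultimately show ?thesis by (simp only: k_def)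
  qed
  finally have *: "norm (\<zeta> (\<tau> (Suc m)) m) ^ 2 \<le> norm z0 ^ 2 - ?D + \<mu> / (2 * G) * norm z0 ^ 2
       + 2 * G * H ^ 2 / \<mu> * N ^ 2 + (4 * H ^ 2 + H) * N ^ 2" by simp
  have "\<mu> * norm z0 ^ 2 \<le> G * ?D + 4 * c * H ^ 3 * N ^ 2"
    unfolding G by (rule excitation_le_dissipation[OF pe len])
  then have "\<mu> * norm z0 ^ 2 / G \<le> (G * ?D + 4 * c * H ^ 3 * N ^ 2) / G"
    using \<open>G > 0\<close> by (intro divide_right_mono) auto
  then have "\<mu> / G * norm z0 ^ 2 \<le> ?D + 4 * c * H ^ 3 / G * N ^ 2"
    using \<open>G > 0\<close> by (simp add: add_divide_distrib)
  with * have "norm (\<zeta> (\<tau> (Suc m)) m) ^ 2 \<le> norm z0 ^ 2 - \<mu> / G * norm z0 ^ 2 + \<mu> / (2 * G) * norm z0 ^ 2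
       + 4 * c * H ^ 3 / G * N ^ 2 + 2 * G * H ^ 2 / \<mu> * N ^ 2 + (4 * H ^ 2 + H) * N ^ 2" by linarith
  moreover have "\<mu> / G * norm z0 ^ 2 = 2 * (\<mu> / (2 * G) * norm z0 ^ 2)" by simp
  ultimately have "norm (\<zeta> (\<tau> (Suc m)) m) ^ 2 \<le> norm z0 ^ 2 - \<mu> / (2 * G) * norm z0 ^ 2
       + (4 * c * H ^ 3 / G * N ^ 2 + 2 * G * H ^ 2 / \<mu> * N ^ 2 + (4 * H ^ 2 + H) * N ^ 2)" by linarith
  also have "\<dots> = (1 - \<mu> / (2 * G)) * norm z0 ^ 2
       + (4 * c * H ^ 3 / G + 4 * H ^ 2 + H + 2 * G * H ^ 2 / \<mu>) * N ^ 2"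
    by (simp only: distrib_right left_diff_distrib mult_1_left)
  finally show ?thesis .
qed

end

section \<open>Geometry of hybrid time domains\<close>

lemma hybrid_times_mono:
  assumes "hybrid_times \<tau> t j T J" "i \<le> k" "j \<le> i" "k \<le> Suc J"
  shows "\<tau> i \<le> \<tau> k"
  using assms(2-4)
proof (induction k rule: dec_induct)
  case (step k)
  then have "\<tau> k \<le> \<tau> (Suc k)" using assms(1) by (simp add: hybrid_times_def)
  with step show ?case by simp
qed simp

lemma hybrid_segment_iff:
  "(a, k) \<in> hybrid_segment \<tau> j J \<longleftrightarrow> k \<in> {j..J} \<and> \<tau> k \<le> a \<and> a \<le> \<tau> (Suc k)"
  by (auto simp: hybrid_segment_def)

lemma hybrid_segment_ends:
  assumes "hybrid_times \<tau> t j T J"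
  shows "(t, j) \<in> hybrid_segment \<tau> j J" "(T, J) \<in> hybrid_segment \<tau> j J"
  using assms by (auto simp: hybrid_segment_iff hybrid_times_def)

lemma hybrid_segment_jump:
  assumes "hybrid_times \<tau> t j T J" "k \<in> {j..<J}"
  shows "(\<tau> (Suc k), k) \<in> hybrid_segment \<tau> j J" "(\<tau> (Suc k), Suc k) \<in> hybrid_segment \<tau> j J"
  using assms by (auto simp: hybrid_segment_iff hybrid_times_def)

lemma hybrid_segment_bounds:
  assumes "hybrid_times \<tau> t j T J" "(a, k) \<in> hybrid_segment \<tau> j J"
  shows "t \<le> a" "a \<le> T" "j \<le> k" "k \<le> J"
proof -
  have k: "k \<in> {j..J}" "\<tau> k \<le> a" "a \<le> \<tau> (Suc k)"
    using assms(2) by (auto simp: hybrid_segment_iff)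
  with hybrid_times_mono[OF assms(1), of j k] hybrid_times_mono[OF assms(1), of "Suc k" "Suc J"] assms(1)
  show "t \<le> a" "a \<le> T" "j \<le> k" "k \<le> J" by (auto simp: hybrid_times_def)
qed

lemma hybrid_domain_ge:
  assumes "hybrid_time_domain_from t0 j0 D" "(T, J) \<in> D"
  shows "t0 \<le> T" "j0 \<le> J"
proof -
  have "D \<subseteq> {t0..} \<times> {j0..}"
    using assms(1) unfolding hybrid_time_domain_from_def by (rule conjunct1)
  then show "t0 \<le> T" "j0 \<le> J" using assms(2) by auto
qed

lemma hybrid_domain_path:
  assumes "hybrid_time_domain_from t0 j0 D" "(T, J) \<in> D"
  obtains \<tau> where "hybrid_times \<tau> t0 j0 T J" "hybrid_segment \<tau> j0 J \<subseteq> D"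
    "D \<inter> ({..T} \<times> {..J}) \<subseteq> hybrid_segment \<tau> j0 J"
proof -
  obtain \<tau> where \<tau>: "hybrid_times \<tau> t0 j0 T J" "D \<inter> ({t0..T} \<times> {j0..J}) = hybrid_segment \<tau> j0 J"
    using assms unfolding hybrid_time_domain_from_def by fast
  have "D \<inter> ({..T} \<times> {..J}) \<subseteq> D \<inter> ({t0..T} \<times> {j0..J})"
    using hybrid_domain_ge[OF assms(1)] by auto
  then have "D \<inter> ({..T} \<times> {..J}) \<subseteq> hybrid_segment \<tau> j0 J" unfolding \<tau>(2) .
  moreover have "hybrid_segment \<tau> j0 J \<subseteq> D" unfolding \<tau>(2)[symmetric] by blast
  ultimately show ?thesis using \<tau>(1) by (intro that)
qed

text \<open>Below a common point of the domain, time does not decrease with the number of jumps. The common point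
  \<open>(T, J)\<close> matters: across the two branches of a fork the conclusion fails.\<close>

lemma hybrid_domain_ordered:
  assumes "hybrid_time_domain_from t0 j0 D" "(T, J) \<in> D"
    and "(a, i) \<in> D" "(b, k) \<in> D" "i < k" "a \<le> T" "b \<le> T" "k \<le> J"
  shows "a \<le> b"
proof -
  obtain \<tau> where \<tau>: "hybrid_times \<tau> t0 j0 T J" "hybrid_segment \<tau> j0 J \<subseteq> D"
    "D \<inter> ({..T} \<times> {..J}) \<subseteq> hybrid_segment \<tau> j0 J"
    by (rule hybrid_domain_path[OF assms(1,2)])
  have "(a, i) \<in> hybrid_segment \<tau> j0 J" "(b, k) \<in> hybrid_segment \<tau> j0 J"
    using assms \<tau>(3) by auto
  then have "a \<le> \<tau> (Suc i)" "\<tau> k \<le> b" "j0 \<le> i" "k \<le> J" by (auto simp: hybrid_segment_iff)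
  with hybrid_times_mono[OF \<tau>(1), of "Suc i" k] \<open>i < k\<close> show ?thesis by simp
qed

lemma hybrid_domain_slice_convex:
  assumes "hybrid_time_domain_from t0 j0 D" "(a, k) \<in> D" "(b, k) \<in> D" "a \<le> x" "x \<le> b"
  shows "(x, k) \<in> D"
proof -
  obtain \<tau> where \<tau>: "hybrid_times \<tau> t0 j0 b k" "hybrid_segment \<tau> j0 k \<subseteq> D"
    "D \<inter> ({..b} \<times> {..k}) \<subseteq> hybrid_segment \<tau> j0 k"
    by (rule hybrid_domain_path[OF assms(1,3)])
  have "(a, k) \<in> hybrid_segment \<tau> j0 k" "(b, k) \<in> hybrid_segment \<tau> j0 k"
    using assms \<tau>(3) by auto
  then have "(x, k) \<in> hybrid_segment \<tau> j0 k" using assms(4,5) by (auto simp: hybrid_segment_iff)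
  then show ?thesis using \<tau>(2) by blast
qed

lemma hybrid_domain_subpath:
  assumes "hybrid_time_domain_from t0 j0 S" "(s, i) \<in> S" "(t, j) \<in> S" "s \<le> t" "i \<le> j"
  obtains \<tau> where "hybrid_times \<tau> s i t j" "hybrid_segment \<tau> i j \<subseteq> S"
proof -
  obtain \<sigma> where \<sigma>: "hybrid_times \<sigma> t0 j0 t j" "hybrid_segment \<sigma> j0 j \<subseteq> S"
    "S \<inter> ({..t} \<times> {..j}) \<subseteq> hybrid_segment \<sigma> j0 j"
    by (rule hybrid_domain_path[OF assms(1,3)])
  have si: "j0 \<le> i" "\<sigma> i \<le> s" "s \<le> \<sigma> (Suc i)"
    using subsetD[OF \<sigma>(3), of "(s, i)"] assms(2,4,5) by (auto simp: hybrid_segment_iff)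
  define \<tau> where "\<tau> = \<sigma>(i := s)"
  have "hybrid_times \<tau> s i t j"
    using \<sigma>(1) si assms(5) by (auto simp: hybrid_times_def \<tau>_def)
  moreover have "hybrid_segment \<tau> i j \<subseteq> hybrid_segment \<sigma> j0 j"
    using si by (auto simp: hybrid_segment_iff \<tau>_def split: if_splits)
  ultimately show ?thesis using \<sigma>(2) by (intro that[of \<tau>]) auto
qed

text \<open>A path in \<open>D\<close> leaves out nothing of \<open>D\<close> in the box that it spans, since any further point would be out of
  order with respect to the jumps of the path. Thus windows of \<open>D\<close> that end before a point of a solution lie
  in the domain of the solution.\<close>

lemma hybrid_path_covers:
  assumes D: "hybrid_time_domain_from t0 j0 D"
    and \<sigma>: "hybrid_times \<sigma> s i t j" "hybrid_segment \<sigma> i j \<subseteq> D"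
    and a: "(a, k) \<in> D" "s \<le> a" "a \<le> t" "i \<le> k" "k \<le> j"
  shows "(a, k) \<in> hybrid_segment \<sigma> i j"
proof -
  have tj: "(t, j) \<in> D" using hybrid_segment_ends[OF \<sigma>(1)] \<sigma>(2) by blast
  have "\<sigma> k \<le> a"
  proof (cases "k = i")
    case True then show ?thesis using \<sigma>(1) a by (simp add: hybrid_times_def)
  next
    case False
    then have k: "k - 1 \<in> {i..<j}" "Suc (k - 1) = k" using a by auto
    have "(\<sigma> k, k - 1) \<in> hybrid_segment \<sigma> i j"
      using hybrid_segment_jump(1)[OF \<sigma>(1) k(1)] k(2) by simp
    then have "(\<sigma> k, k - 1) \<in> D" "\<sigma> k \<le> t"
      using \<sigma>(2) hybrid_segment_bounds(2)[OF \<sigma>(1)] by blast+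
    then show ?thesis
      using k a by (intro hybrid_domain_ordered[OF D tj _ a(1)]) auto
  qed
  moreover have "a \<le> \<sigma> (Suc k)"
  proof (cases "k = j")
    case True then show ?thesis using \<sigma>(1) a by (simp add: hybrid_times_def)
  next
    case False
    then have "k \<in> {i..<j}" using a by auto
    then have "(\<sigma> (Suc k), Suc k) \<in> hybrid_segment \<sigma> i j"
      by (rule hybrid_segment_jump(2)[OF \<sigma>(1)])
    then have m: "(\<sigma> (Suc k), Suc k) \<in> D" "\<sigma> (Suc k) \<le> t"
      using \<sigma>(2) hybrid_segment_bounds(2)[OF \<sigma>(1)] by blast+
    show ?thesis
      by (rule hybrid_domain_ordered[OF D tj a(1) m(1) lessI a(3) m(2)])
         (use \<open>k \<in> {i..<j}\<close> in simp)
  qed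
  ultimately show ?thesis using a by (simp add: hybrid_segment_iff)
qed

lemma hybrid_path_point_at_length:
  assumes "hybrid_times \<tau> s i t j" "s + real i \<le> r" "r \<le> t + real j"
  shows "\<exists>a k. (a, k) \<in> hybrid_segment \<tau> i j \<and> r \<le> a + real k \<and> a + real k \<le> r + 1"
proof -
  have "i \<le> j" using assms(1) by (simp add: hybrid_times_def)
  then show ?thesis using assms
  proof (induction j arbitrary: t rule: dec_induct)
    case base
    then have "(r - real i, i) \<in> hybrid_segment \<tau> i i"
      by (auto simp: hybrid_segment_iff hybrid_times_def)
    then show ?case by (intro exI[of _ "r - real i"] exI[of _ i]) auto
  next
    case (step j)
    have \<tau>: "hybrid_times \<tau> s i (\<tau> (Suc j)) j" "\<tau> (Suc j) \<le> \<tau> (Suc (Suc j))" "\<tau> (Suc (Suc j)) = t"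
      using step by (auto simp: hybrid_times_def)
    consider "r \<le> \<tau> (Suc j) + real j" | "\<tau> (Suc j) + real j < r" "r \<le> \<tau> (Suc j) + real (Suc j)"
      | "\<tau> (Suc j) + real (Suc j) < r" by linarith
    then show ?case
    proof cases
      case 1
      then obtain a k where "(a, k) \<in> hybrid_segment \<tau> i j" "r \<le> a + real k" "a + real k \<le> r + 1"
        using step.IH[OF \<tau>(1) step.prems(2)] by blast
      then show ?thesis by (auto simp: hybrid_segment_iff intro!: exI[of _ a] exI[of _ k])
    next
      case 2
      then show ?thesis using \<tau> step(1)
        by (intro exI[of _ "\<tau> (Suc j)"] exI[of _ "Suc j"]) (auto simp: hybrid_segment_iff)
    next
      case 3
      then show ?thesis using \<tau> step(1) step.prems
        by (intro exI[of _ "r - real (Suc j)"] exI[of _ "Suc j"]) (auto simp: hybrid_segment_iff)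
    qed
  qed
qed

text \<open>A shortest path of length at least \<open>K\<close> overshoots \<open>K\<close> by at most one jump: a final flow could be shortened
  continuously, and a final jump could be dropped.\<close>

lemma hybrid_window_length:
  assumes w: "hybrid_window D t j K \<tau> m" and K: "K > 0"
  shows "hybrid_times \<tau> t j (\<tau> (Suc m)) m" "hybrid_segment \<tau> j m \<subseteq> D"
    "K \<le> \<tau> (Suc m) - t + (real m - real j)" "\<tau> (Suc m) - t + (real m - real j) \<le> K + 1"
proof -
  obtain T where T: "hybrid_times \<tau> t j T m" "hybrid_segment \<tau> j m \<subseteq> D"
    "K \<le> (T - t) + (real m - real j)"
    and least: "\<And>\<tau>' T' m'. hybrid_times \<tau>' t j T' m' \<Longrightarrow> hybrid_segment \<tau>' j m' \<subseteq> D \<Longrightarrow>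
       K \<le> (T' - t) + (real m' - real j) \<Longrightarrow>
       (T - t) + (real m - real j) \<le> (T' - t) + (real m' - real j)"
    using w unfolding hybrid_window_def by blast
  have T_eq: "T = \<tau> (Suc m)" using T(1) by (simp add: hybrid_times_def)
  show "hybrid_times \<tau> t j (\<tau> (Suc m)) m" "hybrid_segment \<tau> j m \<subseteq> D"
    "K \<le> \<tau> (Suc m) - t + (real m - real j)"
    using T T_eq by auto
  show "\<tau> (Suc m) - t + (real m - real j) \<le> K + 1"
  proof (rule ccontr)
    let ?L = "(T - t) + (real m - real j)"
    assume "\<not> ?thesis"
    then have L: "?L > K + 1" by (simp add: T_eq)
    have \<tau>m: "\<tau> m \<le> T" "j \<le> m" "\<tau> j = t" using T(1) by (auto simp: hybrid_times_def)
    show False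
    proof (cases "\<tau> m < T")
      case True
      define T' where "T' = max (\<tau> m) (T - (?L - K))"
      have T': "\<tau> m \<le> T'" "T' < T" "T - (?L - K) \<le> T'" using True L by (auto simp: T'_def)
      have "hybrid_times (\<tau>(Suc m := T')) t j T' m"
        using T(1) T' by (auto simp: hybrid_times_def)
      moreover have "hybrid_segment (\<tau>(Suc m := T')) j m \<subseteq> hybrid_segment \<tau> j m"
        using T' T_eq by (auto simp: hybrid_segment_iff split: if_splits)
      ultimately have "?L \<le> (T' - t) + (real m - real j)"
        using T(2) T' by (intro least[of "\<tau>(Suc m := T')"]) auto
      then show False using T' by simp
    next
      case False
      then have "\<tau> m = T" using \<tau>m by simp
      then have "j < m" using \<tau>m L K by (cases "j = m") auto
      then obtain m' where m: "m = Suc m'" "j \<le> m'" by (cases m) auto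
      have "hybrid_times \<tau> t j T m'"
        using T(1) \<open>\<tau> m = T\<close> m by (auto simp: hybrid_times_def)
      moreover have "hybrid_segment \<tau> j m' \<subseteq> hybrid_segment \<tau> j m"
        using m by (auto simp: hybrid_segment_iff)
      ultimately have "?L \<le> (T - t) + (real m' - real j)"
        using T(2) L m by (intro least[of \<tau>]) auto
      then show False using m by simp
    qed
  qed
qed

lemma hybrid_segment_interior:
  assumes "hybrid_segment \<tau> j m \<subseteq> D" "i \<in> {j..m}"
  shows "{\<tau> i<..<\<tau> (Suc i)} \<subseteq> interior (slice D i)"
proof (rule interior_maximal)
  show "{\<tau> i<..<\<tau> (Suc i)} \<subseteq> slice D i"
    using assms by (force simp: slice_def hybrid_segment_iff)
qed simp

section \<open>Forks\<close>

definition branch_point :: "(real \<times> nat) set \<Rightarrow> real \<Rightarrow> nat \<Rightarrow> bool" where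
  "branch_point D a k \<longleftrightarrow> (a, k) \<in> D \<and> (a, Suc k) \<in> D \<and> (\<exists>b>a. (b, k) \<in> D)"

text \<open>Let \<open>a < c \<le> a'\<close>. If \<open>k \<le> k'\<close>, then the point \<open>(c, k)\<close> of the flow branch is later than the jump
  target \<open>(a, k + 1)\<close>, on a lower level. If \<open>k' < k\<close>, then level \<open>k'\<close> lasts until \<open>c\<close>, although the higher level \<open>k\<close>
  is already reached at time \<open>a\<close>. Either way the slices are out of order.\<close>

lemma branch_point_not_less:
  assumes D: "hybrid_time_domain_from t0 j0 D"
    and "branch_point D a k" "branch_point D a' k'"
  shows "\<not> a < a'"
proof
  assume "a < a'"
  obtain b b' where b: "(a, k) \<in> D" "(a, Suc k) \<in> D" "(b, k) \<in> D" "a < b"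
    and b': "(a', k') \<in> D" "(a', Suc k') \<in> D" "(b', k') \<in> D" "a' < b'"
    using assms by (auto simp: branch_point_def)
  define c where "c = min b a'"
  have c: "a < c" "c \<le> b" "c \<le> a'" using b(4) \<open>a < a'\<close> by (auto simp: c_def)
  show False
  proof (cases "k \<le> k'")
    case True
    have "(c, k) \<in> D"
      using hybrid_domain_slice_convex[OF D b(1,3)] c by simp
    then have "c \<le> a"
      by (rule hybrid_domain_ordered[OF D b'(2) _ b(2)]) (use c True \<open>a < a'\<close> in auto)
    then show False using c by simp
  next
    case False
    obtain \<tau> where \<tau>: "hybrid_times \<tau> t0 j0 a k" "hybrid_segment \<tau> j0 k \<subseteq> D"
      "D \<inter> ({..a} \<times> {..k}) \<subseteq> hybrid_segment \<tau> j0 k"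
      by (rule hybrid_domain_path[OF D b(1)])
    have k': "k' \<in> {j0..<k}" using False hybrid_domain_ge[OF D b'(1)] by auto
    have "(\<tau> (Suc k'), k') \<in> D" "\<tau> (Suc k') \<le> a"
      using hybrid_segment_jump(1)[OF \<tau>(1) k'] \<tau>(2) hybrid_segment_bounds(2)[OF \<tau>(1)] by auto
    then have "(c, k') \<in> D"
      using hybrid_domain_slice_convex[OF D _ b'(1)] c by auto
    then have "c \<le> a"
      by (rule hybrid_domain_ordered[OF D b(3) _ b(1)]) (use c k' in auto)
    then show False using c by simp
  qed
qed

lemma branch_point_unique:
  assumes D: "hybrid_time_domain_from t0 j0 D"
    and bp: "branch_point D a k" "branch_point D a' k'"
  shows "a = a' \<and> k = k'"
proof -
  have "a = a'"
    using branch_point_not_less[OF D bp] branch_point_not_less[OF D bp(2,1)] by simp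
  moreover have "\<not> k < k'" if bp: "branch_point D a k" "branch_point D a k'" for k k'
  proof
    assume "k < k'"
    obtain b b' where b: "(a, k) \<in> D" "(a, Suc k) \<in> D" "(b, k) \<in> D" "a < b"
      and b': "(b', k') \<in> D" "a < b'"
      using bp by (auto simp: branch_point_def)
    have "(min b b', k) \<in> D"
      using hybrid_domain_slice_convex[OF D b(1,3)] b(4) b'(2) by simp
    then have "min b b' \<le> a"
      by (rule hybrid_domain_ordered[OF D b'(1) _ b(2)]) (use \<open>k < k'\<close> b' in auto)
    then show False using b(4) b'(2) by simp
  qed
  ultimately show ?thesis using bp by (meson linorder_cases)
qed

definition unbranched_from :: "(real \<times> nat) set \<Rightarrow> real \<Rightarrow> nat \<Rightarrow> bool" where
  "unbranched_from D s i \<longleftrightarrow> (\<forall>a k. branch_point D a k \<longrightarrow> \<not> (s \<le> a \<and> i \<le> k))"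

lemma unbranched_from_mono:
  "unbranched_from D s i \<Longrightarrow> s \<le> s' \<Longrightarrow> i \<le> i' \<Longrightarrow> unbranched_from D s' i'"
  unfolding unbranched_from_def by (meson order_trans)

lemma eventually_unbranched:
  assumes "hybrid_time_domain_from t0 j0 D"
  shows "\<exists>\<Lambda>\<ge>0. \<forall>s i. \<Lambda> < s + real i \<longrightarrow> unbranched_from D s i"
proof (cases "\<exists>a k. branch_point D a k")
  case True
  then obtain a k where ak: "branch_point D a k" by blast
  have "unbranched_from D s i" if "max 0 (a + real k) < s + real i" for s i
    using that branch_point_unique[OF assms ak] by (fastforce simp: unbranched_from_def)
  then show ?thesis by (intro exI[of _ "max 0 (a + real k)"]) auto
next
  case False
  then show ?thesis by (auto simp: unbranched_from_def)
qed

text \<open>If two points are incomparable, \<open>t < T\<close> and \<open>m < j\<close>, then the path to \<open>(t, j)\<close> leaves level \<open>m\<close> at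
  time \<open>t\<close>, where level \<open>m\<close> continues to \<open>T\<close>: a fork at \<open>(t, m)\<close>.\<close>

lemma unbranched_total:
  assumes D: "hybrid_time_domain_from t0 j0 D" and ub: "unbranched_from D s i"
    and T: "(T, m) \<in> D" "s \<le> T" "i \<le> m" and t: "(t, j) \<in> D" "s \<le> t" "i \<le> j"
  shows "T \<le> t \<and> m \<le> j \<or> t \<le> T \<and> j \<le> m"
proof -
  have no_cross: False
    if T: "(T, m) \<in> D" "s \<le> T" "i \<le> m" and t: "(t, j) \<in> D" "s \<le> t" "i \<le> j"
      and cross: "t < T" "m < j" for T m t j
  proof -
    obtain \<tau> where \<tau>: "hybrid_times \<tau> t0 j0 t j" "hybrid_segment \<tau> j0 j \<subseteq> D"
      "D \<inter> ({..t} \<times> {..j}) \<subseteq> hybrid_segment \<tau> j0 j"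
      by (rule hybrid_domain_path[OF D t(1)])
    have m: "m \<in> {j0..<j}" using hybrid_domain_ge[OF D T(1)] cross by auto
    note jumps = hybrid_segment_jump[OF \<tau>(1) m]
    have le: "\<tau> (Suc m) \<le> t" using hybrid_segment_bounds(2)[OF \<tau>(1) jumps(1)] .
    have "(\<tau> (Suc m), m) \<in> D" using jumps(1) \<tau>(2) by blast
    then have tm: "(t, m) \<in> D"
      using hybrid_domain_slice_convex[OF D _ T(1)] le cross by simp
    then have "(t, m) \<in> hybrid_segment \<tau> j0 j" using cross tm \<tau>(3) by auto
    then have "\<tau> (Suc m) = t" using le by (simp add: hybrid_segment_iff)
    then have "branch_point D t m"
      using tm jumps(2) \<tau>(2) T(1) cross by (auto simp: branch_point_def)
    then show False using ub t(2) T(3) by (simp add: unbranched_from_def)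
  qed
  consider "t < T" | "T < t" | "T = t" by linarith
  then show ?thesis
  proof cases
    case 1 then show ?thesis using no_cross[OF T t] by fastforce
  next
    case 2 then show ?thesis using no_cross[OF t T] by fastforce
  next
    case 3 then show ?thesis by (simp add: linear)
  qed
qed

text \<open>This is what makes \<open>Phi\<close> select the matrix \<open>B\<close> at every jump.\<close>

lemma unbranched_jump_not_interior:
  assumes "unbranched_from D s i" "(a, k) \<in> D" "(a, Suc k) \<in> D" "s \<le> a" "i \<le> k"
  shows "a \<notin> interior (slice D k)"
proof
  assume "a \<in> interior (slice D k)"
  then obtain e where e: "e > 0" "cball a e \<subseteq> slice D k"
    by (meson mem_interior_cball)
  have "a + e \<in> cball a e" using e(1) by (simp add: dist_real_def)
  then have "(a + e, k) \<in> D" using e(2) by (auto simp: slice_def)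
  then have "branch_point D a k" using e(1) assms(2,3) by (auto simp: branch_point_def intro!: exI[of _ "a + e"])
  then show False using assms by (simp add: unbranched_from_def)
qed


section \<open>Exponential decay up to the size of the input\<close>

lemma norm_le_of_sq_le:
  fixes x y e :: real
  assumes "norm z ^ 2 \<le> a * x ^ 2 + b * y ^ 2" "0 \<le> a" "0 \<le> b" "0 \<le> x" "0 \<le> y"
  shows "norm z \<le> sqrt a * x + sqrt b * y"
proof (rule power2_le_imp_le)
  have "0 \<le> 2 * (sqrt a * x) * (sqrt b * y)" using assms by simp
  moreover have "(sqrt a * x + sqrt b * y) ^ 2 = a * x ^ 2 + b * y ^ 2 + 2 * (sqrt a * x) * (sqrt b * y)"
    using assms by (simp add: power2_sum power_mult_distrib)
  ultimately show "norm z ^ 2 \<le> (sqrt a * x + sqrt b * y) ^ 2" using assms(1) by linarith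
qed (use assms in simp)

lemma norm_add_sq_le: 
  fixes x y :: real
  assumes "z \<le> x + y" "0 \<le> z"
  shows "z ^ 2 \<le> 2 * x ^ 2 + 2 * y ^ 2"
proof -
  have "z ^ 2 \<le> (x + y) ^ 2" using assms by (intro power_mono)
  also have "\<dots> \<le> 2 * x ^ 2 + 2 * y ^ 2"
    using sum_squares_bound[of x y] by (simp add: power2_sum)
  finally show ?thesis .
qed

locale excited_system =
  fixes D :: "(real \<times> nat) set" and A B :: "(real^'n^'n) hybrid_signal" and c K \<mu> :: real
  assumes dom: "hybrid_time_domain D"
    and c1: "1 \<le> c"
    and A: "\<And>t j. (t, j) \<in> D \<Longrightarrow> pos_semidef (A t j) \<and> matrix_norm (A t j) \<le> c"
    and B: "\<And>t j. (t, j) \<in> D \<Longrightarrow> pos_semidef (B t j) \<and> matrix_norm (B t j) \<le> 1"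
    and A_arc: "hybrid_arc D A"
    and K: "K > 0" and \<mu>: "\<mu> > 0"
    and pe: "\<And>t j. (t, j) \<in> D \<Longrightarrow> \<exists>\<tau> m. hybrid_window D t j K \<tau> m \<and>
        loewner_le (\<mu> *\<^sub>R mat 1) (hybrid_integral \<tau> j m (Phi D A B))"
begin

text \<open>\<open>H\<close> bounds the length of a window; \<open>G\<close> and \<open>C\<close> are the constants of \<open>window_contraction\<close>. The maximum
  in \<open>\<rho>\<close> keeps the contraction factor positive, so that its logarithm defines a decay rate.\<close>

definition "H = K + 1"
definition "G = 2 + 4 * c ^ 2 * H ^ 2"
definition "C = 4 * c * H ^ 3 / G + 4 * H ^ 2 + H + 2 * G * H ^ 2 / \<mu>"
definition "\<rho> = max (1 / 2) (1 - \<mu> / (2 * G))"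
definition "rate = - ln \<rho> / H"
definition "\<gamma> = 2 * (C / (1 - \<rho>)) + 8 * H ^ 2"

lemma H_pos: "H > 0" using K by (simp add: H_def)
lemma G_pos: "G > 0" by (simp add: G_def add_pos_nonneg)
lemma C_nonneg: "C \<ge> 0"
  using H_pos G_pos c1 \<mu> by (simp add: C_def)
lemma \<rho>: "0 < \<rho>" "\<rho> < 1"
  using G_pos \<mu> by (auto simp: \<rho>_def)
lemma rate_pos: "rate > 0"
  using \<rho> H_pos by (simp add: rate_def field_simps)
lemma exp_rate: "exp (- rate * H) = \<rho>"
  using \<rho> H_pos by (simp add: rate_def)
lemma \<gamma>_nonneg: "\<gamma> \<ge> 0"
  using \<rho> C_nonneg by (simp add: \<gamma>_def)

end

text \<open>The point \<open>(t, j)\<close> at which the solution is estimated is fixed, and \<open>N\<close> bounds the input before it.\<close>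

locale excited_solution = excited_system +
  fixes \<nu> :: "(real^'n) hybrid_signal" and t0 j0 \<zeta>0 S \<zeta> t j N
  assumes sol: "hybrid_solution D A B \<nu> t0 j0 \<zeta>0 S \<zeta>"
    and tj: "(t, j) \<in> S"
    and N0: "0 \<le> N"
    and \<nu>: "\<And>s i. (s, i) \<in> S \<Longrightarrow> s < t \<or> i < j \<Longrightarrow> norm (\<nu> s i) \<le> N"
begin

lemma S_dom: "hybrid_time_domain_from t0 j0 S" and S_sub: "S \<subseteq> D"
  using sol by (simp_all add: hybrid_solution_def)

text \<open>\<open>P\<close> is left open because it is \<open>Phi D A B\<close> on a window beyond the fork, while elsewhere \<open>Phi\<close> may differ
  from \<open>B\<close> at a jump.\<close>

lemma perturbed_path_of_solution:
  assumes \<tau>: "hybrid_times \<tau> s i T m" "hybrid_segment \<tau> i m \<subseteq> S" and "T \<le> t" "m \<le> j"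
    and P_flow: "\<And>k x. k \<in> {i..m} \<Longrightarrow> x \<in> {\<tau> k<..<\<tau> (Suc k)} \<Longrightarrow> P x k = A x k"
    and P_jump: "\<And>k. k \<in> {i..<m} \<Longrightarrow> P (\<tau> (Suc k)) k = B (\<tau> (Suc k)) k"
  shows "perturbed_path \<tau> i m A P \<nu> \<zeta> c N"
proof
  have mem: "(x, k) \<in> S" if "k \<in> {i..m}" "x \<in> {\<tau> k..\<tau> (Suc k)}" for x k
    using that \<tau>(2) by (auto simp: hybrid_segment_iff)
  have slice: "{\<tau> k..\<tau> (Suc k)} \<subseteq> slice S k" if "k \<in> {i..m}" for k
    using mem[OF that] by (auto simp: slice_def)
  have slice_D: "slice S k \<subseteq> slice D k" for k
    using S_sub by (auto simp: slice_def)
  have jumps: "(\<tau> (Suc k), k) \<in> S" "(\<tau> (Suc k), Suc k) \<in> S" if "k \<in> {i..<m}" for k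
    using hybrid_segment_jump[OF \<tau>(1) that] \<tau>(2) by auto
  show "i \<le> m" and mono: "\<And>k. k \<in> {i..m} \<Longrightarrow> \<tau> k \<le> \<tau> (Suc k)"
    using \<tau>(1) by (auto simp: hybrid_times_def)
  show "1 \<le> c" "0 \<le> N" by (fact c1, fact N0)
  show "absolutely_continuous_fun_on {\<tau> k..\<tau> (Suc k)} (\<lambda>t. \<zeta> t k)" if "k \<in> {i..m}" for k
  proof -
    have "hybrid_arc S \<zeta>" using sol by (simp add: hybrid_solution_def)
    then show ?thesis
      using slice[OF that] unfolding hybrid_arc_def locally_absolutely_continuous_on_def by blast
  qed
  show "continuous_on {\<tau> k..\<tau> (Suc k)} (\<lambda>t. A t k)" if "k \<in> {i..m}" for k
  proof (rule absolutely_continuous_imp_continuous_on)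
    show "absolutely_continuous_fun_on {\<tau> k..\<tau> (Suc k)} (\<lambda>t. A t k)"
      using A_arc slice[OF that] slice_D[of k]
      unfolding hybrid_arc_def locally_absolutely_continuous_on_def by blast
  qed
  show "P x k = A x k" if "k \<in> {i..m}" "x \<in> {\<tau> k<..<\<tau> (Suc k)}" for k x
    by (rule P_flow[OF that])
  show "pos_semidef (P x k) \<and> matrix_norm (P x k) \<le> c"
    if k: "k \<in> {i..m}" "x \<in> {\<tau> k<..<\<tau> (Suc k)}" for k x
  proof -
    have "(x, k) \<in> D" using mem[OF k(1), of x] k(2) S_sub by auto
    then show ?thesis using A P_flow[OF k] by simp
  qed
  show "pos_semidef (P (\<tau> (Suc k)) k) \<and> matrix_norm (P (\<tau> (Suc k)) k) \<le> 1" if k: "k \<in> {i..<m}" for k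
  proof -
    have "(\<tau> (Suc k), k) \<in> D" using jumps[OF k] S_sub by blast
    then show ?thesis using B P_jump[OF k] by simp
  qed
  show "norm (\<nu> x k) \<le> N" if k: "k \<in> {i..m}" "x \<in> {\<tau> k<..<\<tau> (Suc k)}" for k x
  proof -
    have "\<tau> (Suc k) \<le> \<tau> (Suc m)"
      using hybrid_times_mono[OF \<tau>(1), of "Suc k" "Suc m"] k(1) by simp
    then have "x < t" using k(2) \<tau>(1) \<open>T \<le> t\<close> by (simp add: hybrid_times_def)
    then show ?thesis using mem[OF k(1), of x] k(2) by (intro \<nu>) auto
  qed
  show "norm (\<nu> (\<tau> (Suc k)) k) \<le> N" if k: "k \<in> {i..<m}" for k
    using jumps(1)[OF k] k \<open>m \<le> j\<close> by (intro \<nu>) auto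
  show "\<zeta> (\<tau> (Suc k)) (Suc k) = (mat 1 - P (\<tau> (Suc k)) k) *v \<zeta> (\<tau> (Suc k)) k + \<nu> (\<tau> (Suc k)) k"
    if k: "k \<in> {i..<m}" for k
  proof -
    have "\<forall>t j. (t, j) \<in> S \<and> (t, Suc j) \<in> S \<longrightarrow> \<zeta> t (Suc j) = (mat 1 - B t j) *v \<zeta> t j + \<nu> t j"
      using sol unfolding hybrid_solution_def by blast
    then show ?thesis using jumps[OF k] P_jump[OF k] by simp
  qed
  show "AE x in lebesgue. x \<in> {\<tau> k<..<\<tau> (Suc k)} \<longrightarrow>
      ((\<lambda>s. \<zeta> s k) has_vector_derivative - (P x k *v \<zeta> x k) + \<nu> x k) (at x within {\<tau> k..\<tau> (Suc k)})"
    if k: "k \<in> {i..m}" for k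
  proof -
    have "AE x in lebesgue. x \<in> slice S k \<and> x \<in> interior (slice D k) \<longrightarrow>
        ((\<lambda>s. \<zeta> s k) has_vector_derivative (- (A x k *v \<zeta> x k) + \<nu> x k)) (at x within slice S k)"
      using sol unfolding hybrid_solution_def by blast
    then show ?thesis
    proof (rule AE_mp, intro AE_I2 impI)
      fix x assume *: "x \<in> slice S k \<and> x \<in> interior (slice D k) \<longrightarrow>
        ((\<lambda>s. \<zeta> s k) has_vector_derivative (- (A x k *v \<zeta> x k) + \<nu> x k)) (at x within slice S k)"
        and x: "x \<in> {\<tau> k<..<\<tau> (Suc k)}"
      have "x \<in> interior (slice D k)"
        using hybrid_segment_interior[OF _ k] \<tau>(2) S_sub x by blast
      moreover have "x \<in> slice S k" using slice[OF k] x by auto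
      ultimately have "((\<lambda>s. \<zeta> s k) has_vector_derivative (- (P x k *v \<zeta> x k) + \<nu> x k)) (at x within slice S k)"
        using * P_flow[OF k x] by simp
      then show "((\<lambda>s. \<zeta> s k) has_vector_derivative - (P x k *v \<zeta> x k) + \<nu> x k) (at x within {\<tau> k..\<tau> (Suc k)})"
        by (rule has_vector_derivative_within_subset[OF _ slice[OF k]])
    qed
  qed
qed

text \<open>Over a stretch of bounded length it is enough that nothing expands, and this holds across a fork too.\<close>

lemma transient_le:
  assumes si: "(s, i) \<in> S" and ak: "(a, k) \<in> S" "s \<le> a" "i \<le> k" "a \<le> t" "k \<le> j"
    and len: "a - s + (real k - real i) \<le> Q"
  shows "norm (\<zeta> a k) ^ 2 \<le> 2 * norm (\<zeta> s i) ^ 2 + 8 * Q ^ 2 * N ^ 2"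
proof -
  obtain \<tau> where \<tau>: "hybrid_times \<tau> s i a k" "hybrid_segment \<tau> i k \<subseteq> S"
    using hybrid_domain_subpath[OF S_dom si ak(1-3)] by metis
  define P where "P x l = (if x \<in> {\<tau> l<..<\<tau> (Suc l)} then A x l else B x l)" for x l
  interpret perturbed_path \<tau> i k A P \<nu> \<zeta> c N
    by (rule perturbed_path_of_solution[OF \<tau> ak(4,5)]) (auto simp: P_def)
  have ends: "\<tau> i = s" "\<tau> (Suc k) = a" using \<tau>(1) by (auto simp: hybrid_times_def)
  have "norm (\<zeta> a k) \<le> norm (\<zeta> s i) + 2 * N * (a - s + (real k - real i))"
    using norm_le[of k a] mono[of k] ak(3) ends by auto
  also have "\<dots> \<le> norm (\<zeta> s i) + 2 * N * Q"
    using len N0 by (intro add_left_mono mult_left_mono) auto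
  finally show ?thesis
    using norm_add_sq_le[of "norm (\<zeta> a k)" "norm (\<zeta> s i)" "2 * N * Q"]
    by (simp add: power_mult_distrib mult_ac)
qed

lemma window_le:
  assumes si: "(s, i) \<in> D" and ub: "unbranched_from D s i"
    and w: "hybrid_window D s i K \<tau> m" "hybrid_segment \<tau> i m \<subseteq> S" "\<tau> (Suc m) \<le> t" "m \<le> j"
    and ex: "loewner_le (\<mu> *\<^sub>R mat 1) (hybrid_integral \<tau> i m (Phi D A B))"
  shows "norm (\<zeta> (\<tau> (Suc m)) m) ^ 2 \<le> \<rho> * norm (\<zeta> s i) ^ 2 + C * N ^ 2"
proof -
  note win = hybrid_window_length[OF w(1) K]
  have P_flow: "Phi D A B x k = A x k" if "k \<in> {i..m}" "x \<in> {\<tau> k<..<\<tau> (Suc k)}" for x k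
    using hybrid_segment_interior[OF win(2) that(1)] that(2) by (auto simp: Phi_def)
  have P_jump: "Phi D A B (\<tau> (Suc k)) k = B (\<tau> (Suc k)) k" if k: "k \<in> {i..<m}" for k
  proof -
    have "(\<tau> (Suc k), k) \<in> D" "(\<tau> (Suc k), Suc k) \<in> D" "s \<le> \<tau> (Suc k)"
      using hybrid_segment_jump[OF win(1) k] win(2) hybrid_segment_bounds(1)[OF win(1)] by auto
    then have "\<tau> (Suc k) \<notin> interior (slice D k)"
      using k by (intro unbranched_jump_not_interior[OF ub]) auto
    then show ?thesis by (simp add: Phi_def)
  qed
  interpret perturbed_path \<tau> i m A "Phi D A B" \<nu> \<zeta> c N
    by (rule perturbed_path_of_solution[OF win(1) w(2-4) P_flow P_jump])
  have start: "\<tau> i = s" using win(1) by (simp add: hybrid_times_def)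
  have "norm (\<zeta> (\<tau> (Suc m)) m) ^ 2 \<le> (1 - \<mu> / (2 * G)) * norm (\<zeta> s i) ^ 2 + C * N ^ 2"
    unfolding C_def start[symmetric]
    by (rule window_contraction[OF ex \<mu> _ _ G_def]) (use win(3,4) K in \<open>auto simp: len_def start H_def\<close>)
  also have "(1 - \<mu> / (2 * G)) * norm (\<zeta> s i) ^ 2 \<le> \<rho> * norm (\<zeta> s i) ^ 2"
    by (intro mult_right_mono) (auto simp: \<rho>_def)
  finally show ?thesis by simp
qed

text \<open>\<open>X\<close> is the fixed point of \<open>V \<mapsto> \<rho> V + C N\<^sup>2\<close>; the part of \<open>V\<close> above it contracts by the factor \<open>\<rho>\<close>
  over each window, so that the contributions of the input do not add up.\<close>

definition "X = C * N ^ 2 / (1 - \<rho>)"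
definition "excess s i = max 0 (norm (\<zeta> s i) ^ 2 - X)"

lemma X_nonneg: "X \<ge> 0" using C_nonneg \<rho> by (simp add: X_def)

lemma \<gamma>_eq: "\<gamma> * N ^ 2 = 2 * X + 8 * H ^ 2 * N ^ 2"
  by (simp add: \<gamma>_def X_def distrib_right)

lemma norm_sq_le_excess: "norm (\<zeta> s i) ^ 2 \<le> excess s i + X"
  by (simp add: excess_def)

text \<open>One window after the other. When the last window passes \<open>(t, j)\<close>, the remaining length is below \<open>H\<close>, which
  costs the factor \<open>exp (rate * H)\<close>.\<close>

lemma unbranched_decay:
  assumes "(s, i) \<in> S" "unbranched_from D s i" "s \<le> t" "i \<le> j"
    and "t + real j - s - real i \<le> real n * K"
  shows "norm (\<zeta> t j) ^ 2
      \<le> 2 * exp (rate * (H - (t + real j - s - real i))) * excess s i + \<gamma> * N ^ 2"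
  using assms
proof (induction n arbitrary: s i)
  case (Suc n)
  let ?l = "t + real j - s - real i"
  have siD: "(s, i) \<in> D" and tjD: "(t, j) \<in> D" using Suc.prems(1) tj S_sub by auto
  obtain \<tau> m where w: "hybrid_window D s i K \<tau> m"
    and ex: "loewner_le (\<mu> *\<^sub>R mat 1) (hybrid_integral \<tau> i m (Phi D A B))"
    using pe[OF siD] by blast
  define T where "T = \<tau> (Suc m)"
  note win = hybrid_window_length[OF w K]
  have Tm: "(T, m) \<in> D" "s \<le> T" "i \<le> m"
    using hybrid_segment_ends(2)[OF win(1)] win(2) hybrid_segment_bounds(1,3)[OF win(1)]
    unfolding T_def by blast+
  consider "t \<le> T" "j \<le> m" | "T \<le> t" "m \<le> j"
    using unbranched_total[OF dom Suc.prems(2) Tm tjD Suc.prems(3,4)] by blast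
  then show ?case
  proof cases
    case 1
    then have l: "?l \<le> H" using win(4) by (simp add: T_def H_def)
    then have "norm (\<zeta> t j) ^ 2 \<le> 2 * norm (\<zeta> s i) ^ 2 + 8 * H ^ 2 * N ^ 2"
      using Suc.prems by (intro transient_le[OF _ tj]) auto
    also have "\<dots> \<le> 2 * excess s i + \<gamma> * N ^ 2"
      using norm_sq_le_excess[of s i] by (simp add: \<gamma>_eq)
    also have "2 * excess s i \<le> 2 * exp (rate * (H - ?l)) * excess s i"
    proof -
      have "1 \<le> exp (rate * (H - ?l))" using l rate_pos by simp
      then show ?thesis by (simp add: excess_def mult_right_mono)
    qed
    finally show ?thesis by simp
  next
    case 2
    obtain \<sigma> where \<sigma>: "hybrid_times \<sigma> s i t j" "hybrid_segment \<sigma> i j \<subseteq> S"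
      using hybrid_domain_subpath[OF S_dom Suc.prems(1) tj Suc.prems(3,4)] by metis
    have seg: "hybrid_segment \<tau> i m \<subseteq> S"
    proof
      fix z assume z: "z \<in> hybrid_segment \<tau> i m"
      obtain a k where ak: "z = (a, k)" by (cases z)
      have "s \<le> a" "a \<le> T" "i \<le> k" "k \<le> m"
        using hybrid_segment_bounds[OF win(1)] z unfolding ak T_def by blast+
      moreover have "(a, k) \<in> D" using z win(2) ak by blast
      moreover have "hybrid_segment \<sigma> i j \<subseteq> D" using \<sigma>(2) S_sub by blast
      ultimately have "(a, k) \<in> hybrid_segment \<sigma> i j"
        using 2 by (intro hybrid_path_covers[OF dom \<sigma>(1)]) auto
      then show "z \<in> S" using \<sigma>(2) ak by blast
    qed
    have TmS: "(T, m) \<in> S"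
      using hybrid_segment_ends(2)[OF win(1)] seg unfolding T_def by blast
    have "norm (\<zeta> T m) ^ 2 \<le> \<rho> * norm (\<zeta> s i) ^ 2 + C * N ^ 2"
      using window_le[OF siD Suc.prems(2) w seg _ _ ex] 2 unfolding T_def by blast
    moreover have "C * N ^ 2 = (1 - \<rho>) * X" using \<rho> by (simp add: X_def)
    ultimately have "norm (\<zeta> T m) ^ 2 - X \<le> \<rho> * (norm (\<zeta> s i) ^ 2 - X)"
      by (simp add: algebra_simps)
    also have "\<dots> \<le> \<rho> * excess s i"
      using \<rho> by (intro mult_left_mono) (auto simp: excess_def)
    finally have step: "excess T m \<le> \<rho> * excess s i"
      using \<rho> by (simp add: excess_def)
    have "norm (\<zeta> t j) ^ 2 \<le> 2 * exp (rate * (H - (t + real j - T - real m))) * excess T m + \<gamma> * N ^ 2"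
    proof (rule Suc.IH[OF TmS])
      show "unbranched_from D T m" by (rule unbranched_from_mono[OF Suc.prems(2) Tm(2,3)])
      show "t + real j - T - real m \<le> real n * K"
        using Suc.prems(5) win(3) by (simp add: T_def algebra_simps)
    qed (use 2 in auto)
    also have "2 * exp (rate * (H - (t + real j - T - real m))) * excess T m
        \<le> 2 * exp (rate * (H - (t + real j - T - real m))) * (exp (- rate * H) * excess s i)"
      using step exp_rate by (intro mult_left_mono) auto
    also have "\<dots> = 2 * (exp (rate * (H - (t + real j - T - real m))) * exp (- rate * H)) * excess s i"
      by simp
    also have "exp (rate * (H - (t + real j - T - real m))) * exp (- rate * H)
        = exp (- rate * (t + real j - T - real m))"
      by (simp add: exp_add[symmetric] algebra_simps)
    also have "2 * exp (- rate * (t + real j - T - real m)) * excess s i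
        \<le> 2 * exp (rate * (H - ?l)) * excess s i"
    proof (intro mult_right_mono mult_left_mono)
      have "T - s + (real m - real i) \<le> H" using win(4) by (simp add: T_def H_def)
      then have "rate * (- (t + real j - T - real m)) \<le> rate * (H - ?l)"
        using rate_pos by (intro mult_left_mono) auto
      then show "exp (- rate * (t + real j - T - real m)) \<le> exp (rate * (H - ?l))"
        by (simp only: exp_le_cancel_iff mult_minus_left mult_minus_right)
    qed (auto simp: excess_def)
    finally show ?thesis by simp
  qed
next
  case 0
  then have st: "s = t" "i = j" by auto
  have "norm (\<zeta> t j) ^ 2 \<le> excess s i + X"
    using norm_sq_le_excess[of s i] by (simp add: st)
  also have "excess s i \<le> 2 * exp (rate * (H - (t + real j - s - real i))) * excess s i"
  proof -
    have "1 \<le> exp (rate * (H - (t + real j - s - real i)))" using H_pos rate_pos st by simp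
    then have "1 \<le> 2 * exp (rate * (H - (t + real j - s - real i)))" by linarith
    from mult_right_mono[OF this, of "excess s i"] show ?thesis
      unfolding excess_def by simp
  qed
  also have "X \<le> \<gamma> * N ^ 2"
    using X_nonneg by (simp add: \<gamma>_eq)
  finally show ?case by simp
qed

text \<open>Up to the fork the trajectory is followed without contraction, to a point at length between \<open>\<Lambda> + 1\<close>
  and \<open>\<Lambda> + 2\<close> from the start, from where the domain no longer forks.\<close>

lemma decay:
  assumes \<Lambda>: "0 \<le> \<Lambda>" "\<And>s i. \<Lambda> < s + real i \<Longrightarrow> unbranched_from D s i"
    and si: "(s, i) \<in> S" "s \<le> t" "i \<le> j"
  shows "norm (\<zeta> t j) ^ 2 \<le> 4 * exp (rate * (H + (\<Lambda> + 2) - (t + real j - s - real i))) * norm (\<zeta> s i) ^ 2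
           + (16 * exp (rate * H) * (\<Lambda> + 2) ^ 2 + \<gamma>) * N ^ 2"
proof (cases "t + real j - s - real i \<le> \<Lambda> + 2")
  case True
  let ?E = "exp (rate * (H + (\<Lambda> + 2) - (t + real j - s - real i)))"
  have "norm (\<zeta> t j) ^ 2 \<le> 2 * norm (\<zeta> s i) ^ 2 + 8 * (\<Lambda> + 2) ^ 2 * N ^ 2"
    using True si by (intro transient_le[OF _ tj]) auto
  moreover have "2 * norm (\<zeta> s i) ^ 2 \<le> 4 * ?E * norm (\<zeta> s i) ^ 2"
  proof (intro mult_right_mono)
    have "1 \<le> ?E" using True H_pos rate_pos by simp
    then show "2 \<le> 4 * ?E" by linarith
  qed simp
  moreover have "8 * (\<Lambda> + 2) ^ 2 * N ^ 2 \<le> (16 * exp (rate * H) * (\<Lambda> + 2) ^ 2 + \<gamma>) * N ^ 2"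
  proof (intro mult_right_mono)
    have "1 \<le> exp (rate * H)" using H_pos rate_pos by simp
    then have "8 \<le> 16 * exp (rate * H)" by linarith
    then have "8 * (\<Lambda> + 2) ^ 2 \<le> 16 * exp (rate * H) * (\<Lambda> + 2) ^ 2" by (rule mult_right_mono) simp
    then show "8 * (\<Lambda> + 2) ^ 2 \<le> 16 * exp (rate * H) * (\<Lambda> + 2) ^ 2 + \<gamma>" using \<gamma>_nonneg by linarith
  qed simp
  ultimately show ?thesis by linarith
next
  case False
  obtain \<tau> where \<tau>: "hybrid_times \<tau> s i t j" "hybrid_segment \<tau> i j \<subseteq> S"
    using hybrid_domain_subpath[OF S_dom si(1) tj si(2,3)] by metis
  have s0: "0 \<le> s" using hybrid_domain_ge(1)[OF dom] si(1) S_sub by blast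
  obtain a k where ak: "(a, k) \<in> hybrid_segment \<tau> i j" "s + real i + \<Lambda> + 1 \<le> a + real k"
    "a + real k \<le> s + real i + \<Lambda> + 1 + 1"
    using hybrid_path_point_at_length[OF \<tau>(1), of "s + real i + \<Lambda> + 1"] False \<Lambda>(1) by auto
  have akS: "(a, k) \<in> S" "s \<le> a" "i \<le> k" "a \<le> t" "k \<le> j"
    using ak(1) \<tau>(2) hybrid_segment_bounds[OF \<tau>(1) ak(1)] by auto
  let ?l = "t + real j - s - real i" and ?l' = "t + real j - a - real k"
  obtain n where "?l' / K \<le> real n" using real_arch_simple by blast
  then have n: "?l' \<le> real n * K" using K by (simp add: field_simps)
  have mid: "norm (\<zeta> a k) ^ 2 \<le> 2 * norm (\<zeta> s i) ^ 2 + 8 * (\<Lambda> + 2) ^ 2 * N ^ 2"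
    using ak(3) by (intro transient_le si akS) auto
  have ub: "unbranched_from D a k" using ak(2) s0 by (intro \<Lambda>(2)) auto
  have "norm (\<zeta> t j) ^ 2 \<le> 2 * exp (rate * (H - ?l')) * excess a k + \<gamma> * N ^ 2"
    by (rule unbranched_decay[OF akS(1) ub akS(4,5) n])
  also have "excess a k \<le> norm (\<zeta> a k) ^ 2" using X_nonneg by (simp add: excess_def)
  also note mid
  also have "2 * exp (rate * (H - ?l')) * (2 * norm (\<zeta> s i) ^ 2 + 8 * (\<Lambda> + 2) ^ 2 * N ^ 2)
     = 4 * exp (rate * (H - ?l')) * norm (\<zeta> s i) ^ 2 + 16 * exp (rate * (H - ?l')) * (\<Lambda> + 2) ^ 2 * N ^ 2"
    by (simp add: algebra_simps)
  also have "4 * exp (rate * (H - ?l')) * norm (\<zeta> s i) ^ 2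
      \<le> 4 * exp (rate * (H + (\<Lambda> + 2) - ?l)) * norm (\<zeta> s i) ^ 2"
    using ak(3) rate_pos by (intro mult_right_mono mult_left_mono) auto
  also have "16 * exp (rate * (H - ?l')) * (\<Lambda> + 2) ^ 2 * N ^ 2 \<le> 16 * exp (rate * H) * (\<Lambda> + 2) ^ 2 * N ^ 2"
    using akS rate_pos by (intro mult_right_mono mult_left_mono) auto
  finally show ?thesis by (simp add: algebra_simps)
qed

end

theorem (in excited_system) exponential_iss:
  "\<exists>\<kappa>>0. \<exists>lam>0. \<exists>\<gamma>>0. \<forall>\<nu> t0 j0 \<zeta>0 S \<zeta> t j N.
     hybrid_solution D A B \<nu> t0 j0 \<zeta>0 S \<zeta> \<longrightarrow> (t, j) \<in> S \<longrightarrow> 0 \<le> N \<longrightarrow>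
     (\<forall>s i. (s, i) \<in> S \<longrightarrow> s < t \<or> i < j \<longrightarrow> norm (\<nu> s i) \<le> N) \<longrightarrow>
     norm (\<zeta> t j) \<le> \<kappa> * norm \<zeta>0 * exp (- lam * (t + real j - t0 - real j0)) + \<gamma> * N"
proof -
  obtain \<Lambda> where \<Lambda>: "0 \<le> \<Lambda>" "\<And>s i. \<Lambda> < s + real i \<Longrightarrow> unbranched_from D s i"
    using eventually_unbranched[OF dom] by blast
  define E where "E = exp (rate * (H + (\<Lambda> + 2)))"
  define g where "g = 16 * exp (rate * H) * (\<Lambda> + 2) ^ 2 + \<gamma>"
  have "16 * exp (rate * H) * (\<Lambda> + 2) ^ 2 > 0" using \<Lambda>(1) by simp
  then have g: "g > 0" using \<gamma>_nonneg by (simp add: g_def)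
  have main: "norm (\<zeta> t j) \<le> sqrt (4 * E) * norm \<zeta>0 * exp (- (rate / 2) * (t + real j - t0 - real j0)) + sqrt g * N"
    if sol: "hybrid_solution D A B \<nu> t0 j0 \<zeta>0 S \<zeta>" and tj: "(t, j) \<in> S" and N: "0 \<le> N"
      "\<And>s i. (s, i) \<in> S \<Longrightarrow> s < t \<or> i < j \<Longrightarrow> norm (\<nu> s i) \<le> N"
    for \<nu> :: "(real^'n) hybrid_signal" and t0 j0 \<zeta>0 S \<zeta> t j N
  proof -
    interpret excited_solution D A B c K \<mu> \<nu> t0 j0 \<zeta>0 S \<zeta> t j N
      by unfold_locales (use sol tj N in auto)
    let ?l = "t + real j - t0 - real j0"
    have start: "(t0, j0) \<in> S" "\<zeta> t0 j0 = \<zeta>0" using sol by (auto simp: hybrid_solution_def)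
    have "norm (\<zeta> t j) ^ 2 \<le> 4 * exp (rate * (H + (\<Lambda> + 2) - ?l)) * norm \<zeta>0 ^ 2 + g * N ^ 2"
      using decay[OF \<Lambda> start(1) hybrid_domain_ge[OF S_dom tj]] by (simp add: g_def start)
    also have "exp (rate * (H + (\<Lambda> + 2) - ?l)) = E * exp (- (rate / 2) * ?l) ^ 2"
      by (simp add: E_def exp_add[symmetric] power2_eq_square algebra_simps)
    finally have "norm (\<zeta> t j) ^ 2 \<le> (4 * E) * (norm \<zeta>0 * exp (- (rate / 2) * ?l)) ^ 2 + g * N ^ 2"
      by (simp add: power_mult_distrib mult_ac)
    from norm_le_of_sq_le[OF this] show ?thesis
      using g N by (simp add: E_def mult.assoc)
  qed
  have pos: "sqrt (4 * E) > 0" "rate / 2 > 0" "sqrt g > 0"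
    using g rate_pos by (simp_all add: E_def)
  show ?thesis
  proof (rule exI, rule conjI[OF pos(1)], rule exI, rule conjI[OF pos(2)], rule exI, rule conjI[OF pos(3)],
      intro allI impI)
    fix \<nu> t0 j0 \<zeta>0 S and \<zeta> :: "(real^'n) hybrid_signal" and t j N
    assume "hybrid_solution D A B \<nu> t0 j0 \<zeta>0 S \<zeta>" "(t, j) \<in> S" "0 \<le> N"
      and "\<forall>s i. (s, i) \<in> S \<longrightarrow> s < t \<or> i < j \<longrightarrow> norm (\<nu> s i) \<le> N"
    then show "norm (\<zeta> t j) \<le> sqrt (4 * E) * norm \<zeta>0 * exp (- (rate / 2) * (t + real j - t0 - real j0)) + sqrt g * N"
      by (intro main) blast+
  qed
qed

section \<open>Stability\<close>

lemma class_K_inf_linear: "\<gamma> > 0 \<Longrightarrow> class_K_inf (\<lambda>r. \<gamma> * r)"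
  unfolding class_K_inf_def class_K_def
  by (auto intro!: continuous_intros strict_mono_onI filterlim_tendsto_pos_mult_at_top[of _ \<gamma>] filterlim_ident)

lemma class_KL_exponential:
  assumes "\<kappa> > 0" "lam > 0"
  shows "class_KL (\<lambda>r s. \<kappa> * r * exp (- lam * s))"
  unfolding class_KL_def class_K_def
proof (intro conjI allI impI)
  show "continuous_on ({0..} \<times> {0..}) (\<lambda>(r, s). \<kappa> * r * exp (- lam * s))"
    unfolding split_def by (intro continuous_intros)
  show "continuous_on {0..} (\<lambda>r. \<kappa> * r * exp (- lam * s))" for s
    by (intro continuous_intros)
  show "strict_mono_on {0..} (\<lambda>r. \<kappa> * r * exp (- lam * s))" for s
    using assms by (auto intro!: strict_mono_onI)
  show "antimono_on {0..} (\<lambda>s. \<kappa> * r * exp (- lam * s))" if "r \<ge> 0" for r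
    using assms that by (auto intro!: monotone_onI mult_left_mono)
  have "((\<lambda>s. exp (- lam * s)) \<longlongrightarrow> 0) at_top"
    using assms by (intro filterlim_compose[OF exp_at_bot]
        filterlim_tendsto_neg_mult_at_bot[OF tendsto_const _ filterlim_ident]) simp
  then show "((\<lambda>s. \<kappa> * r * exp (- lam * s)) \<longlongrightarrow> 0) at_top" for r
    using tendsto_mult_right_zero by fast
qed simp

theorem theorem4:
  fixes D :: "(real \<times> nat) set"
    and A B :: "(real^'n^'n) hybrid_signal"
    and \<nu> :: "(real^'n) hybrid_signal"
  assumes dom: "hybrid_time_domain D"
    and bounded: "\<exists>Abar>0. \<exists>Bbar>0. \<forall>(t, j)\<in>D.
          matrix_norm (A t j) \<le> Abar \<and> matrix_norm (B t j) \<le> Bbar"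
    and A_psd: "\<forall>(t, j)\<in>D. pos_semidef (A t j)"
    and B_psd: "\<forall>(t, j)\<in>D. pos_semidef (B t j) \<and> matrix_norm (B t j) \<le> 1"
    and hpe: "HPE D A B"
  shows "UES D A B \<and> ISS D A B \<nu>"
proof -
  obtain Abar where Abar: "\<And>t j. (t, j) \<in> D \<Longrightarrow> matrix_norm (A t j) \<le> Abar"
    using bounded by fast
  obtain K \<mu> where "K > 0" "\<mu> > 0" and windows: "\<forall>(t, j)\<in>D. \<exists>\<tau> m. hybrid_window D t j K \<tau> m \<and>
        loewner_le (\<mu> *\<^sub>R mat 1) (hybrid_integral \<tau> j m (Phi D A B))"
    using hpe unfolding HPE_def by (elim conjE exE) (rule that)
  have pe: "\<exists>\<tau> m. hybrid_window D t j K \<tau> m \<and>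
        loewner_le (\<mu> *\<^sub>R mat 1) (hybrid_integral \<tau> j m (Phi D A B))" if "(t, j) \<in> D" for t j
    using bspec[OF windows that] unfolding prod.case .
  have arc: "hybrid_arc D A" using hpe unfolding HPE_def by (rule conjunct1)
  have system: "excited_system D A B (max 1 Abar) K \<mu>"
  proof (rule excited_system.intro)
    show "hybrid_time_domain D" by (rule dom)
    show "1 \<le> max 1 Abar" by simp
    show "hybrid_arc D A" by (rule arc)
    show "0 < K" "0 < \<mu>" by fact+
    show "pos_semidef (A t j) \<and> matrix_norm (A t j) \<le> max 1 Abar" if "(t, j) \<in> D" for t j
      using bspec[OF A_psd that] Abar[OF that] by simp
    show "pos_semidef (B t j) \<and> matrix_norm (B t j) \<le> 1" if "(t, j) \<in> D" for t j
      using bspec[OF B_psd that] by simp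
    show "\<exists>\<tau> m. hybrid_window D t j K \<tau> m \<and>
        loewner_le (\<mu> *\<^sub>R mat 1) (hybrid_integral \<tau> j m (Phi D A B))" if "(t, j) \<in> D" for t j
      by (rule pe[OF that])
  qed
  obtain \<kappa> lam g where pos: "\<kappa> > 0" "lam > 0" "g > 0"
    and est: "\<forall>\<nu> t0 j0 \<zeta>0 S \<zeta> t j N.
     hybrid_solution D A B \<nu> t0 j0 \<zeta>0 S \<zeta> \<longrightarrow> (t, j) \<in> S \<longrightarrow> 0 \<le> N \<longrightarrow>
     (\<forall>s i. (s, i) \<in> S \<longrightarrow> s < t \<or> i < j \<longrightarrow> norm (\<nu> s i) \<le> N) \<longrightarrow>
     norm (\<zeta> t j) \<le> \<kappa> * norm \<zeta>0 * exp (- lam * (t + real j - t0 - real j0)) + g * N"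
    using excited_system.exponential_iss[OF system] by (elim exE conjE) (rule that)
  have "UES D A B"
    unfolding UES_def
  proof (rule exI[of _ \<kappa>], intro conjI pos, rule exI[of _ lam], intro conjI pos allI impI, clarify)
    fix t0 j0 \<zeta>0 S and \<zeta> :: "(real^'n) hybrid_signal" and t j
    assume "hybrid_solution D A B (\<lambda>_ _. 0) t0 j0 \<zeta>0 S \<zeta>" "(t, j) \<in> S"
    from est[rule_format, OF this, of 0] show "norm (\<zeta> t j) \<le> \<kappa> * norm \<zeta>0 * exp (- lam * (t + real j - t0 - real j0))"
      by simp
  qed
  moreover have "ISS D A B \<nu>"
    unfolding ISS_def
  proof (intro exI[of _ "\<lambda>r. g * r"] exI[of _ "\<lambda>r s. \<kappa> * r * exp (- lam * s)"] conjI
      class_K_inf_linear class_KL_exponential pos allI impI, clarify)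
    fix t0 j0 \<zeta>0 S and \<zeta> :: "(real^'n) hybrid_signal" and t j
    assume sol: "hybrid_solution D A B \<nu> t0 j0 \<zeta>0 S \<zeta>" and tj: "(t, j) \<in> hybrid_from S t0 j0"
    let ?V = "(\<lambda>(s, i). norm (\<nu> s i)) ` (S - hybrid_from S t j)"
    have "norm (\<zeta> t j) \<le> \<kappa> * norm \<zeta>0 * exp (- lam * (t + real j - t0 - real j0)) + g * Sup (insert 0 ?V)"
      if bdd: "bdd_above ?V"
    proof (rule est[rule_format, OF sol])
      have bdd0: "bdd_above (insert 0 ?V)" using bdd by simp
      show "0 \<le> Sup (insert 0 ?V)" by (rule cSup_upper[OF _ bdd0]) simp
      show "norm (\<nu> s i) \<le> Sup (insert 0 ?V)" if "(s, i) \<in> S" "s < t \<or> i < j" for s i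
      proof -
        have "norm (\<nu> s i) \<in> ?V" using that by (force simp: hybrid_from_def)
        then show ?thesis by (intro cSup_upper[OF _ bdd0]) simp
      qed
    qed (use tj in \<open>simp add: hybrid_from_def\<close>)
    then show "let V = ?V in bdd_above V \<longrightarrow>
        norm (\<zeta> t j) \<le> \<kappa> * norm \<zeta>0 * exp (- lam * (t + real j - t0 - real j0)) + g * Sup (insert 0 V)"
      by (simp add: Let_def)
  qed
  ultimately show ?thesis by blast
qed

end
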